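(* $$\varepsilon(e^{-2\pi})=\frac{e^{\pi/12}\left(2+\sqrt3+\tfrac12(\sqrt2+\sqrt6)\,3^{3/4}\right)}{3^{3/8}(\sqrt3+1)^{5/6}(1+\sqrt3+\sqrt2\cdot 3^{3/4})^{2/3}}\,\frac{\pi^{1/4}}{\Gamma(\tfrac34)}.$$
   Context: For $q\in\mathbf{C}$ with $|q|<1$, $\varepsilon(q)=\sum_{k=-\infty}^{\infty}q^{k(3k+1)/2}$. $\Gamma$ is the Gamma function; all roots and fractional powers are of positive reals and denote the positive value. *)

theory Defs
  imports "HOL-Analysis.Analysis"
begin

(* The bilateral series sum_k q^(k(3k+1)/2), with all signs positive, for norm q < 1.
   The product k(3k+1) is even and nonnegative for every integer k, so the division is exact.
   The series converges absolutely for norm q < 1, hence unordered summation over the integers is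
   the usual two-sided sum; outside the disc the value carries no meaning. *)
definition eps :: "complex \<Rightarrow> complex" where
  "eps q = (\<Sum>\<^sub>\<infinity>k\<in>(UNIV :: int set). q powi (k * (3 * k + 1) div 2))"

end

theory Submission
  imports Defs "HOL-Probability.Characteristic_Functions" "HOL-Real_Asymp.Real_Asymp"
begin

text \<open>
  Completing the square gives \<open>eps (exp (- 2 * pi)) = exp (pi / 12) * theta 3 (1 / 6)\<close>, where
  \<open>theta t b\<close> is the sum of \<open>exp (- pi * t * (k + b)\<^sup>2)\<close> over all integers \<open>k\<close>.
  Poisson summation at \<open>t = 3\<close>, with the Fourier series split modulo 3, makes \<open>theta 3 (1 / 6)\<close>
  a linear combination of the theta constants \<open>\<theta>2\<close> and \<open>\<theta>4\<close> at \<open>t = 3\<close>.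
  Their ratios to \<open>\<theta>3\<close> follow from the modular equation of degree 3 (an identity in the hexagonal
  lattice) together with Jacobi's quartic identity, because \<open>\<theta>2 = \<theta>4\<close> at \<open>t = 1\<close>.
  Splitting the sum over the four-dimensional integer lattice along a sublattice similar to it
  (cut out by the tetracode) relates \<open>\<theta>3 3\<close> to \<open>\<theta>3 1\<close>. Finally the squares of \<open>\<theta>3\<close> and \<open>\<theta>4\<close>
  follow the arithmetic-geometric mean iteration under \<open>t \<mapsto> 2 * t\<close>, so Gauss' invariant
  integral evaluates \<open>\<theta>3 1\<close> as a Beta value.
\<close>

section \<open>Theta series and Poisson summation\<close>

text \<open>The argument closes because inversion fixes t = 1 and exchanges 3 with 1/3, while
  trisection multiplies t by 9 and so brings 1/3 back to 3: every relation at level three involves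
  values at 3 alone or compares them with values at 1. One comparison needs four dimensions because
  3 is not a sum of two squares: the square lattice has no similarity of norm 3, the
  four-dimensional integer lattice has one. This gives the ratio of \<open>\<theta>3 1\<close> to
  \<open>\<theta>3 3\<close> through its fourth power. The algebraic relations fix the ratios only
  up to a choice of roots; positivity of the theta constants and one explicit upper bound for
  \<open>\<theta>2 3\<close> select the right ones. All series stay real and unordered, with cosine
  series in place of complex Fourier series. The arithmetic-geometric mean itself is never defined:
  the integral is constant along t = 2^n, and there its parameters are known to tend to 1.\<close>

lemma summable_on_power_nat_abs:
  fixes r :: real
  assumes "0 \<le> r" "r < 1"
  shows "(\<lambda>k::int. r ^ nat \<bar>k\<bar>) summable_on UNIV"
proof -
  have s: "(\<lambda>n. r ^ n) summable_on UNIV"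
    using assms by (intro summable_nonneg_imp_summable_on summable_geometric) auto
  have 1: "(\<lambda>k::int. r ^ nat \<bar>k\<bar>) summable_on range int"
    by (subst summable_on_reindex) (auto simp: o_def s)
  have 2: "(\<lambda>k::int. r ^ nat \<bar>k\<bar>) summable_on range (\<lambda>n. - int n)"
    by (subst summable_on_reindex) (auto simp: o_def s inj_on_def)
  have "UNIV = range int \<union> range (\<lambda>n. - int n)"
    by (auto intro: int_cases2)
  with summable_on_union[OF 1 2] show ?thesis by simp
qed

definition theta :: "real \<Rightarrow> real \<Rightarrow> real" where
  "theta t b = (\<Sum>\<^sub>\<infinity>k\<in>(UNIV :: int set). exp (- (pi * t * (of_int k + b)\<^sup>2)))"

text \<open>This is the Fourier side of \<open>theta\<close>: a cosine series with Gaussian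
  coefficients. Real cosines suffice because the periodized Gaussian is even in
  \<open>b\<close>.\<close>

definition ctheta :: "real \<Rightarrow> real \<Rightarrow> real" where
  "ctheta t b = (\<Sum>\<^sub>\<infinity>n\<in>(UNIV :: int set). exp (- (pi * t * (of_int n)\<^sup>2)) * cos (2 * pi * of_int n * b))"

lemma theta_summable:
  assumes "t > 0"
  shows "(\<lambda>k::int. exp (- (pi * t * (of_int k + b)\<^sup>2))) summable_on UNIV"
proof (rule summable_on_comparison_test)
  define C where "C = exp (pi * t * (\<bar>b\<bar> + 1))"
  have "exp (- (pi * t)) < (1::real)" using assms by simp
  then show "(\<lambda>k::int. C * exp (- (pi * t)) ^ nat \<bar>k\<bar>) summable_on UNIV"
    by (intro summable_on_cmult_right summable_on_power_nat_abs) auto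
  fix k :: int
  \<comment> \<open>A linear lower bound for the square is enough: it puts the Gaussian terms below
    a geometric series in the absolute value of \<open>k\<close>.\<close>
  have "0 \<le> (\<bar>of_int k + b\<bar> - 1/2)\<^sup>2" by simp
  then have "\<bar>of_int k + b\<bar> - 1 \<le> (of_int k + b)\<^sup>2"
    by (simp add: power2_eq_square algebra_simps abs_mult_self_eq)
  then have "\<bar>of_int k\<bar> - (\<bar>b\<bar> + 1) \<le> (of_int k + b)\<^sup>2" by linarith
  then have "pi * t * (\<bar>of_int k\<bar> - (\<bar>b\<bar> + 1)) \<le> pi * t * (of_int k + b)\<^sup>2"
    using assms by (intro mult_left_mono) auto
  then have "exp (- (pi * t * (of_int k + b)\<^sup>2)) \<le> exp (pi * t * (\<bar>b\<bar> + 1) + of_nat (nat \<bar>k\<bar>) * (- (pi * t)))"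
    by (simp add: algebra_simps)
  also have "\<dots> = C * exp (- (pi * t)) ^ nat \<bar>k\<bar>"
    unfolding C_def exp_add exp_of_nat_mult ..
  finally show "exp (- (pi * t * (of_int k + b)\<^sup>2)) \<le> C * exp (- (pi * t)) ^ nat \<bar>k\<bar>" .
qed auto

lemma theta_has_sum:
  assumes "t > 0"
  shows "((\<lambda>k::int. exp (- (pi * t * (of_int k + b)\<^sup>2))) has_sum theta t b) UNIV"
  unfolding theta_def by (rule has_sum_infsum[OF theta_summable[OF assms]])

lemma ctheta_abs_summable:
  assumes "t > 0"
  shows "(\<lambda>n::int. norm (exp (- (pi * t * (of_int n)\<^sup>2)) * cos (2 * pi * of_int n * b))) summable_on UNIV"
proof (rule Infinite_Sum.abs_summable_on_comparison_test)
  show "(\<lambda>k::int. norm (exp (- (pi * t * (of_int k + 0)\<^sup>2)))) summable_on UNIV"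
    using theta_summable[OF assms, of 0] by (simp del: add_0_right)
qed (simp add: abs_mult mult_left_le)

lemma ctheta_has_sum:
  assumes "t > 0"
  shows "((\<lambda>n::int. exp (- (pi * t * (of_int n)\<^sup>2)) * cos (2 * pi * of_int n * b)) has_sum ctheta t b) UNIV"
  unfolding ctheta_def
  by (rule has_sum_infsum[OF Infinite_Sum.abs_summable_summable[OF ctheta_abs_summable[OF assms]]])

lemma theta_pos:
  assumes "t > 0"
  shows "theta t b > 0"
proof -
  have "(\<Sum>k\<in>{0::int}. exp (- (pi * t * (of_int k + b)\<^sup>2))) \<le> theta t b"
    by (rule finite_sum_le_has_sum[OF theta_has_sum[OF assms]]) auto
  moreover have "0 < (\<Sum>k\<in>{0::int}. exp (- (pi * t * (of_int k + b)\<^sup>2)))"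
    by simp
  ultimately show ?thesis by linarith
qed

lemma theta_neg: "theta t (- b) = theta t b"
  unfolding theta_def
  by (rule infsum_reindex_bij_witness[of _ uminus uminus]) (auto simp: power2_eq_square algebra_simps)

lemma theta_add_int: "theta t (b + of_int m) = theta t b"
  unfolding theta_def
  by (rule infsum_reindex_bij_witness[of _ "\<lambda>k. k - m" "\<lambda>k. k + m"]) (auto simp: algebra_simps)

lemma ctheta_0: "ctheta t 0 = theta t 0"
  by (simp add: ctheta_def theta_def)

text \<open>The real part of the characteristic function of the standard normal law, rescaled. The
  factor \<open>r\<close> is sqrt (2 * pi) and removes the normalization of the density;
  \<open>c\<close> is chosen with c^2 = 2 * pi * t, and \<open>s\<close> with s * c = 2 * pi *
  y.\<close>

lemma gaussian_cos_integral:
  assumes t: "t > 0"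
  shows "has_bochner_integral lborel (\<lambda>x. exp (- (pi * t * x\<^sup>2)) * cos (2 * pi * y * x))
           (exp (- (pi * y\<^sup>2 / t)) / sqrt t)"
proof -
  obtain r :: real where r: "r > 0" "r\<^sup>2 = 2 * pi" "r = sqrt (2 * pi)"
    by (metis real_sqrt_gt_0_iff pi_gt_zero mult_pos_pos zero_less_numeral real_sqrt_pow2 less_imp_le)
  define c where "c = r * sqrt t"
  define s where "s = r * y / sqrt t"
  have c: "c > 0" "c\<^sup>2 = 2 * pi * t" using t r(1,2) by (auto simp: c_def power_mult_distrib)
  have iexp: "complex_integrable std_normal_distribution (\<lambda>x. iexp (s * x))"
    using real_distribution.axioms(1)[OF real_dist_normal_dist]
    by (intro prob_space.integrable_iexp) auto
  have "integrable std_normal_distribution (\<lambda>x. cos (s * x))"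
    using integrable_Re[OF iexp] by (simp add: Re_exp)
  moreover have "(LINT x|std_normal_distribution. cos (s * x)) = exp (- s\<^sup>2 / 2)"
    using arg_cong[OF fun_cong[OF char_std_normal_distribution, of s], of Re]
    unfolding char_def integral_Re[OF iexp, symmetric] by (simp add: Re_exp)
  ultimately have "has_bochner_integral std_normal_distribution (\<lambda>x. cos (s * x)) (exp (- s\<^sup>2 / 2))"
    by (simp add: has_bochner_integral_iff)
  then have "has_bochner_integral lborel (\<lambda>x. std_normal_density x * cos (s * x)) (exp (- s\<^sup>2 / 2))"
    by (simp add: has_bochner_integral_iff integral_density integrable_density normal_density_nonneg)
  then have "has_bochner_integral lborel (\<lambda>x. std_normal_density (0 + c * x) * cos (s * (0 + c * x))) (exp (- s\<^sup>2 / 2) /\<^sub>R \<bar>c\<bar>)"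
    using c by (subst (asm) lborel_has_bochner_integral_real_affine_iff[of c _ _ 0]) auto
  then have "has_bochner_integral lborel (\<lambda>x. r * (std_normal_density (0 + c * x) * cos (s * (0 + c * x))))
     (r * (exp (- s\<^sup>2 / 2) /\<^sub>R \<bar>c\<bar>))"
    by (intro has_bochner_integral_mult_right) auto
  also have "r * (exp (- s\<^sup>2 / 2) /\<^sub>R \<bar>c\<bar>) = exp (- (pi * y\<^sup>2 / t)) / sqrt t"
  proof -
    have s: "s\<^sup>2 / 2 = pi * y\<^sup>2 / t"
      using t by (simp add: s_def power_divide power_mult_distrib r(2))
    have rc: "r / \<bar>c\<bar> = 1 / sqrt t"
      using t r(1) by (simp add: c_def)
    have "r * (exp (- s\<^sup>2 / 2) /\<^sub>R \<bar>c\<bar>) = exp (- (s\<^sup>2 / 2)) * (r / \<bar>c\<bar>)"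
      by (simp only: real_scaleR_def divide_inverse mult_minus_left mult_minus_right mult_ac)
    also have "\<dots> = exp (- (pi * y\<^sup>2 / t)) / sqrt t"
      unfolding s rc by simp
    finally show ?thesis .
  qed
  also have "(\<lambda>x. r * (std_normal_density (0 + c * x) * cos (s * (0 + c * x)))) =
      (\<lambda>x. exp (- (pi * t * x\<^sup>2)) * cos (2 * pi * y * x))"
  proof
    fix x
    have "s * c = r\<^sup>2 * y" using t by (simp add: s_def c_def power2_eq_square)
    then have "s * c = 2 * pi * y" unfolding r(2) .
    moreover have "r * std_normal_density (c * x) = exp (- (pi * t * x\<^sup>2))"
      using r c by (simp add: std_normal_density_def power_mult_distrib)
    ultimately show "r * (std_normal_density (0 + c * x) * cos (s * (0 + c * x))) =
      exp (- (pi * t * x\<^sup>2)) * cos (2 * pi * y * x)"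
      by (simp only: add_0_left mult.assoc[symmetric])
  qed
  finally show ?thesis .
qed

text \<open>The M-test gives uniform convergence along the filter of finite index sets, and a
  uniform limit inherits continuity and commutes with the integral. No enumeration of the index set
  is involved.\<close>

lemma has_sum_integral_Weierstrass:
  fixes f :: "'a \<Rightarrow> real \<Rightarrow> real"
  assumes cont: "\<And>k. continuous_on {a..b} (f k)"
    and bound: "\<And>k x. x \<in> {a..b} \<Longrightarrow> \<bar>f k x\<bar> \<le> M k"
    and M: "M summable_on UNIV"
    and F: "\<And>x. x \<in> {a..b} \<Longrightarrow> ((\<lambda>k. f k x) has_sum F x) UNIV"
  shows "continuous_on {a..b} F"
    and "((\<lambda>k. integral {a..b} (f k)) has_sum integral {a..b} F) UNIV"
proof -
  have u: "uniform_limit {a..b} (\<lambda>X x. \<Sum>k\<in>X. f k x) F (finite_subsets_at_top UNIV)"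
    by (rule Weierstrass_m_test_general'[where M = M]) (use bound M F in auto)
  show "continuous_on {a..b} F"
    by (rule uniform_limit_theorem[OF _ u]) (auto intro!: continuous_on_sum cont)
  obtain I J where IJ: "\<And>X. ((\<lambda>x. \<Sum>k\<in>X. f k x) has_integral I X) {a..b}"
    "(F has_integral J) {a..b}" "(I \<longlongrightarrow> J) (finite_subsets_at_top UNIV)"
    by (rule uniform_limit_integral[OF u]) (auto intro!: continuous_on_sum cont)
  have "I X = (\<Sum>k\<in>X. integral {a..b} (f k))" if "finite X" for X
    by (rule has_integral_unique[OF IJ(1)])
      (intro has_integral_sum that integrable_integral integrable_continuous_interval cont)
  then have "((\<lambda>X. \<Sum>k\<in>X. integral {a..b} (f k)) \<longlongrightarrow> J) (finite_subsets_at_top UNIV)"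
    by (intro Lim_transform_eventually[OF IJ(3)]) (auto intro: eventually_finite_subsets_at_top_weakI)
  with IJ(2) show "((\<lambda>k. integral {a..b} (f k)) has_sum integral {a..b} F) UNIV"
    by (simp add: has_sum_def integral_unique)
qed

text \<open>Lets an unordered sum over the integers be evaluated along symmetric partial sums. The
  intervals are half-open because index \<open>k\<close> stands for the unit interval from
  \<open>k\<close> to k + 1, and these must tile the interval from -N to N.\<close>

lemma filterlim_symmetric_int_interval:
  "filterlim (\<lambda>N. {- int N..<int N}) (finite_subsets_at_top UNIV) sequentially"
  unfolding filterlim_finite_subsets_at_top
proof safe
  fix X :: "int set" assume "finite X"
  define N where "N = Suc (Max (insert 0 ((\<lambda>k. nat \<bar>k\<bar>) ` X)))"
  have "X \<subseteq> {- int n..<int n}" if "n \<ge> N" for n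
  proof
    fix k assume "k \<in> X"
    then have "nat \<bar>k\<bar> \<le> Max (insert 0 ((\<lambda>k. nat \<bar>k\<bar>) ` X))"
      using \<open>finite X\<close> by (intro Max_ge) auto
    with that have "nat \<bar>k\<bar> < n" by (simp add: N_def)
    then show "k \<in> {- int n..<int n}" by auto
  qed
  then show "\<forall>\<^sub>F n in sequentially. finite {- int n..<int n} \<and> X \<subseteq> {- int n..<int n} \<and> {- int n..<int n} \<subseteq> UNIV"
    by (auto intro!: eventually_sequentiallyI[of N])
qed

lemma sum_integral_unit_intervals:
  fixes h :: "real \<Rightarrow> real"
  assumes "continuous_on UNIV h"
  shows "(\<Sum>k\<in>{- int N..<int N}. integral {of_int k..of_int k + 1} h) = integral {- real N..real N} h"
proof -
  have int: "h integrable_on {a..b}" for a b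
    using assms by (meson continuous_on_subset integrable_continuous_interval subset_UNIV)
  show ?thesis
  proof (induction N)
    case (Suc N)
    have "{- int (Suc N)..<int (Suc N)} = insert (- int (Suc N)) (insert (int N) {- int N..<int N})"
      by auto
    then have "(\<Sum>k\<in>{- int (Suc N)..<int (Suc N)}. integral {of_int k..of_int k + 1} h) =
      integral {- real (Suc N)..- real N} h + (integral {real N..real (Suc N)} h +
        (\<Sum>k\<in>{- int N..<int N}. integral {of_int k..of_int k + 1} h))"
      by (simp add: add_ac)
    also have "\<dots> = integral {- real (Suc N)..- real N} h + (integral {real N..real (Suc N)} h + integral {- real N..real N} h)"
      unfolding Suc.IH ..
    also have "\<dots> = integral {- real (Suc N)..real (Suc N)} h"
      using Henstock_Kurzweil_Integration.integral_combine[OF _ _ int, of "- real (Suc N)" "- real N" "real (Suc N)"]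
        Henstock_Kurzweil_Integration.integral_combine[OF _ _ int, of "- real N" "real N" "real (Suc N)"] by linarith
    finally show ?case .
  qed simp
qed

lemma has_integral_UNIV_limit:
  fixes h :: "real \<Rightarrow> real"
  assumes "(h has_integral I) UNIV"
  shows "(\<lambda>N. integral {- real N..real N} h) \<longlonglongrightarrow> I"
proof (rule LIMSEQ_I)
  fix e :: real assume "e > 0"
  with assms obtain B where B: "B > 0" "\<And>a b. ball 0 B \<subseteq> cbox a b \<Longrightarrow> norm (integral (cbox a b) h - I) < e"
    unfolding has_integral_alt'[of h I UNIV] by auto
  have "norm (integral {- real N..real N} h - I) < e" if "N \<ge> nat \<lceil>B\<rceil>" for N
    using B(2)[of "- real N" "real N"] that by (force simp: dist_real_def)
  then show "\<exists>no. \<forall>n\<ge>no. norm (integral {- real n..real n} h - I) < e" by blast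
qed

section \<open>Uniqueness of cosine coefficients\<close>

lemma integral_cos_cos:
  fixes m n :: int
  shows "integral {0..1} (\<lambda>x. cos (2 * pi * of_int m * x) * cos (2 * pi * of_int n * x)) =
    ((if m = n then 1 / 2 else 0) + (if m = - n then 1 / 2 else 0) :: real)"
proof -
  have c: "((\<lambda>x. cos (2 * pi * of_int k * x)) has_integral (if k = 0 then 1 else 0)) {0..1::real}" for k :: int
  proof (cases "k = 0")
    case True
    then show ?thesis using has_integral_const_real[of "1::real" 0 1] by simp
  next
    case False
    have "((\<lambda>x. cos (2 * pi * of_int k * x)) has_integral
      sin (2 * pi * of_int k * 1) / (2 * pi * of_int k) - sin (2 * pi * of_int k * 0) / (2 * pi * of_int k)) {0..1::real}"
      using False by (intro fundamental_theorem_of_calculus)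
        (auto intro!: derivative_eq_intros simp: has_real_derivative_iff_has_vector_derivative[symmetric])
    moreover have "sin (2 * pi * of_int k * 1) = 0"
      using sin_int_2pin[of k] by (simp add: mult_ac)
    ultimately show ?thesis using False by simp
  qed
  have "((\<lambda>x. cos (2 * pi * of_int (m - n) * x) / 2 + cos (2 * pi * of_int (m + n) * x) / 2) has_integral
     ((if m - n = 0 then 1 else 0) / 2 + (if m + n = 0 then 1 else 0) / 2)) {0..1::real}"
    by (intro has_integral_add has_integral_divide c)
  moreover have "cos (2 * pi * of_int (m - n) * x) / 2 + cos (2 * pi * of_int (m + n) * x) / 2 =
     cos (2 * pi * of_int m * x) * cos (2 * pi * of_int n * x)" for x :: real
    by (simp add: cos_times_cos algebra_simps)
  ultimately show ?thesis
    by (auto simp: integral_unique eq_neg_iff_add_eq_0)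
qed

text \<open>The product formula trades one factor cos (2 * pi * x) for the frequencies n + 1 and n -
  1, so the induction on \<open>k\<close> needs all \<open>n\<close> at once. Hence \<open>H\<close>
  is orthogonal to every polynomial in cos (2 * pi * x).\<close>

lemma integral_cos_power_eq_0:
  fixes H :: "real \<Rightarrow> real"
  assumes H: "continuous_on {0..1} H"
    and zero: "\<And>n::int. integral {0..1} (\<lambda>x. H x * cos (2 * pi * of_int n * x)) = 0"
  shows "integral {0..1} (\<lambda>x. H x * cos (2 * pi * x) ^ k * cos (2 * pi * of_int n * x)) = 0"
proof (induction k arbitrary: n)
  case 0
  show ?case using zero[of n] by simp
next
  case (Suc k)
  let ?f = "\<lambda>n x. H x * cos (2 * pi * x) ^ k * cos (2 * pi * of_int n * x)"
  have int: "?f n integrable_on {0..1}" for n :: int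
    by (intro integrable_continuous_interval continuous_intros H)
  have "H x * cos (2 * pi * x) ^ Suc k * cos (2 * pi * of_int n * x) = (?f (n + 1) x + ?f (n - 1) x) / 2" for x
  proof -
    have "cos (2 * pi * x) * cos (2 * pi * of_int n * x) =
       (cos (2 * pi * of_int (n + 1) * x) + cos (2 * pi * of_int (n - 1) * x)) / 2"
      using cos_times_cos[of "2 * pi * of_int n * x" "2 * pi * x"] by (simp add: algebra_simps)
    moreover have "H x * cos (2 * pi * x) ^ Suc k * cos (2 * pi * of_int n * x) =
       H x * cos (2 * pi * x) ^ k * (cos (2 * pi * x) * cos (2 * pi * of_int n * x))"
      by (simp only: power_Suc2 mult.assoc)
    ultimately show ?thesis by (simp only: distrib_left times_divide_eq_right)
  qed
  then have "integral {0..1} (\<lambda>x. H x * cos (2 * pi * x) ^ Suc k * cos (2 * pi * of_int n * x)) =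
     integral {0..1} (\<lambda>x. (?f (n + 1) x + ?f (n - 1) x) / 2)"
    by presburger
  also have "\<dots> = (integral {0..1} (?f (n + 1)) + integral {0..1} (?f (n - 1))) / 2"
    using integral_add[OF int[of "n + 1"] int[of "n - 1"]] by (simp only: integral_divide)
  also have "\<dots> = 0" using Suc[of "n + 1"] Suc[of "n - 1"] by (simp only:) simp
  finally show ?case .
qed

text \<open>By symmetry \<open>H\<close> is a continuous function \<open>h\<close> of cos (2 * pi *
  x). Approximating \<open>h\<close> uniformly by polynomials, to which \<open>H\<close> is
  orthogonal, forces the integral of the square of \<open>H\<close> to vanish.\<close>

lemma cosine_coefficients_unique:
  fixes H :: "real \<Rightarrow> real"
  assumes H: "continuous_on {0..1} H"
    and sym: "\<And>x. H (1 - x) = H x"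
    and zero: "\<And>n::int. integral {0..1} (\<lambda>x. H x * cos (2 * pi * of_int n * x)) = 0"
    and x: "x \<in> {0..1}"
  shows "H x = 0"
proof -
  define h where "h = (\<lambda>c. H (arccos c / (2 * pi)))"
  have "continuous_on {-1..1} h"
    unfolding h_def
  proof (rule continuous_on_compose2[OF H])
    show "(\<lambda>c. arccos c / (2 * pi)) ` {- 1..1} \<subseteq> {0..1}"
    proof safe
      fix c :: real assume "c \<in> {- 1..1}"
      then have "0 \<le> arccos c" "arccos c \<le> pi" by (auto intro: arccos_lbound arccos_ubound)
      then show "arccos c / (2 * pi) \<in> {0..1}" by (auto simp: field_simps)
    qed
  qed (auto intro!: continuous_intros)
  have hcos: "h (cos (2 * pi * x)) = H x" if "x \<in> {0..1}" for x
  proof (cases "x \<le> 1 / 2")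
    case True
    then have "arccos (cos (2 * pi * x)) = 2 * pi * x"
      using that by (intro arccos_cos) auto
    then show ?thesis by (simp add: h_def)
  next
    case False
    have "cos (2 * pi * x) = cos (2 * pi * (1 - x))"
      by (simp add: algebra_simps cos_diff)
    moreover have "arccos (cos (2 * pi * (1 - x))) = 2 * pi * (1 - x)"
      using that False by (intro arccos_cos) auto
    ultimately show ?thesis using sym[of x] by (simp add: h_def)
  qed
  have "bounded (H ` {0..1})"
    by (intro compact_imp_bounded compact_continuous_image H) auto
  then obtain B where "\<forall>x\<in>{0..1}. \<bar>H x\<bar> \<le> B"
    unfolding bounded_iff by auto
  then have B: "\<bar>H x\<bar> \<le> B" if "x \<in> {0..1}" for x
    using that by blast
  have B0: "B \<ge> 0" using B[of 0] by auto
  have "\<bar>integral {0..1} (\<lambda>x. H x * H x)\<bar> \<le> e" if "e > 0" for e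
  proof -
    \<comment> \<open>The bound \<open>B\<close> may be 0, hence the tolerance e / (B + 1);
      multiplied by \<open>B\<close> it stays below \<open>e\<close>.\<close>
    have "e / (B + 1) > 0" using that B0 by simp
    then obtain p where p: "real_polynomial_function p" "\<And>c. c \<in> {-1..1} \<Longrightarrow> \<bar>h c - p c\<bar> < e / (B + 1)"
      using Stone_Weierstrass_real_polynomial_function[OF compact_Icc \<open>continuous_on {-1..1} h\<close>] by metis
    then obtain a n where pa: "p = (\<lambda>c. \<Sum>i\<le>n. a i * c ^ i)"
      using real_polynomial_function_iff_sum by auto
    have cp: "continuous_on {0..1} (\<lambda>x. p (cos (2 * pi * x)))"
      unfolding pa by (intro continuous_intros)
    have "integral {0..1} (\<lambda>x. H x * p (cos (2 * pi * x))) =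
       integral {0..1} (\<lambda>x. \<Sum>i\<le>n. a i * (H x * cos (2 * pi * x) ^ i * cos (2 * pi * of_int 0 * x)))"
      by (simp add: pa sum_distrib_left mult_ac)
    also have "\<dots> = (\<Sum>i\<le>n. integral {0..1} (\<lambda>x. a i * (H x * cos (2 * pi * x) ^ i * cos (2 * pi * of_int 0 * x))))"
      by (intro integral_sum integrable_continuous_interval continuous_intros H) auto
    also have "\<dots> = 0"
      by (simp only: integral_mult_right integral_cos_power_eq_0[OF H zero]) simp
    finally have "integral {0..1} (\<lambda>x. H x * H x) = integral {0..1} (\<lambda>x. H x * H x - H x * p (cos (2 * pi * x)))"
      by (subst integral_diff) (auto intro!: integrable_continuous_interval continuous_intros H cp)
    moreover have "norm (integral {0..1} (\<lambda>x. H x * H x - H x * p (cos (2 * pi * x)))) \<le> (B * (e / (B + 1))) * (1 - 0)"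
    proof (rule integral_bound)
      fix x :: real assume x: "x \<in> {0..1}"
      have "\<bar>H x - p (cos (2 * pi * x))\<bar> \<le> e / (B + 1)"
        using p(2)[of "cos (2 * pi * x)"] hcos[OF x] by simp
      then have "\<bar>H x\<bar> * \<bar>H x - p (cos (2 * pi * x))\<bar> \<le> B * (e / (B + 1))"
        using B[OF x] B0 by (intro mult_mono) auto
      then show "norm (H x * H x - H x * p (cos (2 * pi * x))) \<le> B * (e / (B + 1))"
        by (simp add: abs_mult[symmetric] right_diff_distrib)
    qed (auto intro!: continuous_intros H cp)
    moreover have "B * (e / (B + 1)) \<le> e" using that B0 by (simp add: field_simps)
    ultimately show ?thesis by simp
  qed
  then have "integral {0..1} (\<lambda>x. H x * H x) = 0"
    using field_le_epsilon[of "\<bar>integral {0..1} (\<lambda>x. H x * H x)\<bar>" 0] by simp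
  then have "\<forall>x\<in>{0..1}. H x * H x = 0"
    by (subst (asm) integral_eq_0_iff) (auto intro!: continuous_intros H)
  with x show ?thesis by simp
qed

text \<open>On the unit interval the distance of k + x from 0 is smallest at an endpoint. Adding
  both endpoint terms gives a summable majorant that does not depend on \<open>x\<close>.\<close>

lemma theta_bound_unit:
  fixes k :: int and x :: real
  assumes "t > 0" "x \<in> {0..1}"
  shows "exp (- (pi * t * (of_int k + x)\<^sup>2)) \<le>
    exp (- (pi * t * (of_int k + 0)\<^sup>2)) + exp (- (pi * t * (of_int k + 1)\<^sup>2))"
proof (cases "k \<ge> 0")
  case True
  then have "(of_int k + 0)\<^sup>2 \<le> (of_int k + x)\<^sup>2"
    using assms by (intro power_mono) auto
  then have "exp (- (pi * t * (of_int k + x)\<^sup>2)) \<le> exp (- (pi * t * (of_int k + 0)\<^sup>2))"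
    using assms by simp
  then show ?thesis by (rule add_increasing2[rotated]) simp
next
  case False
  then have "of_int k + 1 \<le> (0::real)" by linarith
  then have "(of_int k + 1)\<^sup>2 \<le> (of_int k + x)\<^sup>2"
    using assms by (subst (1 2) power2_minus[symmetric], intro power_mono) auto
  then have "exp (- (pi * t * (of_int k + x)\<^sup>2)) \<le> exp (- (pi * t * (of_int k + 1)\<^sup>2))"
    using assms by simp
  then show ?thesis by (rule add_increasing[rotated]) simp
qed

text \<open>Unfolding: integrating a periodized function against a cosine of integer frequency over
  one period equals integrating the original function over the whole line, where the Gaussian
  transform applies.\<close>

lemma theta_Fourier:
  fixes n :: int
  assumes t: "t > 0"
  shows "continuous_on {0..1} (theta t)"
    and "integral {0..1} (\<lambda>x. theta t x * cos (2 * pi * of_int n * x)) = exp (- (pi * (of_int n)\<^sup>2 / t)) / sqrt t"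
proof -
  define M where "M = (\<lambda>k::int. exp (- (pi * t * (of_int k + 0)\<^sup>2)) + exp (- (pi * t * (of_int k + 1)\<^sup>2)))"
  have M: "M summable_on UNIV"
    unfolding M_def by (intro summable_on_add theta_summable t)
  show "continuous_on {0..1} (theta t)"
    by (rule has_sum_integral_Weierstrass(1)[where M = M and f = "\<lambda>k x. exp (- (pi * t * (of_int k + x)\<^sup>2))"])
      (use theta_bound_unit[OF t] in \<open>auto intro!: continuous_intros M[unfolded M_def, simplified] theta_has_sum t simp: M_def\<close>)
  define h where "h = (\<lambda>x. exp (- (pi * t * x\<^sup>2)) * cos (2 * pi * of_int n * x))"
  have h: "continuous_on A h" for A
    unfolding h_def by (intro continuous_intros)
  have "((\<lambda>k. integral {0..1} (\<lambda>x. exp (- (pi * t * (of_int k + x)\<^sup>2)) * cos (2 * pi * of_int n * x))) has_sum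
     integral {0..1} (\<lambda>x. theta t x * cos (2 * pi * of_int n * x))) (UNIV :: int set)"
  proof (rule has_sum_integral_Weierstrass(2)[where M = M])
    fix k :: int and x :: real assume "x \<in> {0..1}"
    then have "exp (- (pi * t * (of_int k + x)\<^sup>2)) \<le> M k"
      using theta_bound_unit[OF t] by (simp add: M_def)
    then show "\<bar>exp (- (pi * t * (of_int k + x)\<^sup>2)) * cos (2 * pi * of_int n * x)\<bar> \<le> M k"
      using abs_cos_le_one[of "2 * pi * of_int n * x"]
      unfolding abs_mult abs_exp_cancel by (intro order_trans[OF mult_left_le]) auto
  qed (auto intro!: continuous_intros M has_sum_cmult_left theta_has_sum t)
  moreover have "integral {0..1} (\<lambda>x. exp (- (pi * t * (of_int k + x)\<^sup>2)) * cos (2 * pi * of_int n * x)) =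
     integral {of_int k..of_int k + 1} h" for k :: int
  proof -
    \<comment> \<open>An integer frequency makes the cosine invariant under the shift by
      \<open>k\<close>, so the terms are pieces of one and the same function
      \<open>h\<close>.\<close>
    have "cos (2 * pi * of_int n * (of_int k + x)) = cos (2 * pi * of_int n * x)" for x :: real
    proof -
      have "2 * pi * of_int n * (of_int k + x) = 2 * pi * of_int (n * k) + 2 * pi * of_int n * x"
        by (simp add: algebra_simps)
      then show ?thesis
        using sin_int_2pin[of "n * k"] cos_int_2pin[of "n * k"] by (simp only: cos_add)
    qed
    then show ?thesis
      using integral_shift_Icc_real[of 0 1 h "of_int k"] by (simp add: h_def o_def add_ac)
  qed
  ultimately have "((\<lambda>k::int. integral {of_int k..of_int k + 1} h) has_sum
      integral {0..1} (\<lambda>x. theta t x * cos (2 * pi * of_int n * x))) UNIV"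
    by simp
  from filterlim_compose[OF this[unfolded has_sum_def] filterlim_symmetric_int_interval]
  have "(\<lambda>N. integral {- real N..real N} h) \<longlonglongrightarrow> integral {0..1} (\<lambda>x. theta t x * cos (2 * pi * of_int n * x))"
    by (simp add: sum_integral_unit_intervals[OF h])
  moreover have "(h has_integral exp (- (pi * (of_int n)\<^sup>2 / t)) / sqrt t) UNIV"
    using gaussian_cos_integral[OF t, of "of_int n"] has_integral_integral_lborel[of h]
    by (simp add: has_bochner_integral_iff h_def)
  ultimately show "integral {0..1} (\<lambda>x. theta t x * cos (2 * pi * of_int n * x)) = exp (- (pi * (of_int n)\<^sup>2 / t)) / sqrt t"
    by (rule LIMSEQ_unique[OF _ has_integral_UNIV_limit])
qed

lemma ctheta_Fourier:
  fixes n :: int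
  assumes t: "t > 0"
  shows "continuous_on {0..1} (ctheta t)"
    and "integral {0..1} (\<lambda>x. ctheta t x * cos (2 * pi * of_int n * x)) = exp (- (pi * t * (of_int n)\<^sup>2))"
proof -
  define M where "M = (\<lambda>k::int. exp (- (pi * t * (of_int k + 0)\<^sup>2)))"
  have M: "M summable_on UNIV"
    unfolding M_def by (intro theta_summable t)
  show "continuous_on {0..1} (ctheta t)"
    by (rule has_sum_integral_Weierstrass(1)[where M = M and
        f = "\<lambda>k x. exp (- (pi * t * (of_int k)\<^sup>2)) * cos (2 * pi * of_int k * x)"])
      (auto intro!: continuous_intros M[unfolded M_def, simplified] ctheta_has_sum t simp: M_def abs_mult mult_left_le)
  have bound: "\<bar>exp (- (pi * t * (of_int k)\<^sup>2)) * cos (2 * pi * of_int k * x) * cos (2 * pi * of_int n * x)\<bar> \<le> M k" for k :: int and x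
  proof -
    have "\<bar>cos (2 * pi * of_int k * x)\<bar> * \<bar>cos (2 * pi * of_int n * x)\<bar> \<le> 1"
      by (intro mult_le_one) auto
    then show ?thesis
      unfolding abs_mult mult.assoc M_def by (simp add: mult_left_le)
  qed
  have "((\<lambda>k. integral {0..1} (\<lambda>x. exp (- (pi * t * (of_int k)\<^sup>2)) * cos (2 * pi * of_int k * x) * cos (2 * pi * of_int n * x))) has_sum
     integral {0..1} (\<lambda>x. ctheta t x * cos (2 * pi * of_int n * x))) (UNIV :: int set)"
    by (rule has_sum_integral_Weierstrass(2)[where M = M])
      (auto intro!: continuous_intros M has_sum_cmult_left ctheta_has_sum t bound)
  moreover have "integral {0..1} (\<lambda>x. exp (- (pi * t * (of_int k)\<^sup>2)) * cos (2 * pi * of_int k * x) * cos (2 * pi * of_int n * x)) =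
     (if k = n then exp (- (pi * t * (of_int n)\<^sup>2)) / 2 else 0) + (if k = - n then exp (- (pi * t * (of_int n)\<^sup>2)) / 2 else 0)" for k :: int
    using integral_cos_cos[of k n] by (simp add: mult.assoc)
  ultimately have "((\<lambda>k::int. (if k = n then exp (- (pi * t * (of_int n)\<^sup>2)) / 2 else 0) + (if k = - n then exp (- (pi * t * (of_int n)\<^sup>2)) / 2 else 0)) has_sum
      integral {0..1} (\<lambda>x. ctheta t x * cos (2 * pi * of_int n * x))) UNIV"
    by simp
  \<comment> \<open>Only k = n and k = -n survive, each with half of the coefficient. Keeping them
    as two separate one-point sums lets n = 0 receive both halves.\<close>
  moreover have "((\<lambda>k::int. (if k = n then exp (- (pi * t * (of_int n)\<^sup>2)) / 2 else 0) + (if k = - n then exp (- (pi * t * (of_int n)\<^sup>2)) / 2 else 0)) has_sum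
      (exp (- (pi * t * (of_int n)\<^sup>2)) / 2 + exp (- (pi * t * (of_int n)\<^sup>2)) / 2)) UNIV"
    by (intro has_sum_add has_sum_finite_neutralI[where B = "{n}"] has_sum_finite_neutralI[where B = "{- n}"]) auto
  ultimately show "integral {0..1} (\<lambda>x. ctheta t x * cos (2 * pi * of_int n * x)) = exp (- (pi * t * (of_int n)\<^sup>2))"
    using has_sum_unique by fastforce
qed

text \<open>Both sides are continuous and symmetric under x -> 1 - x and have equal cosine
  coefficients. The range of \<open>b\<close> is the interval on which coefficients determine the
  function.\<close>

theorem Poisson_theta:
  assumes t: "t > 0" and b: "b \<in> {0..1}"
  shows "ctheta (1 / t) b = sqrt t * theta t b"
proof -
  have t': "1 / t > 0" using t by simp
  have "theta t b - ctheta (1 / t) b / sqrt t = 0"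
  proof (rule cosine_coefficients_unique[OF _ _ _ b])
    show "continuous_on {0..1} (\<lambda>x. theta t x - ctheta (1 / t) x / sqrt t)"
      using t by (intro continuous_intros theta_Fourier ctheta_Fourier t') auto
    fix x :: real
    have "theta t (1 - x) = theta t x"
      using theta_add_int[of t "- x" 1] by (simp add: theta_neg)
    moreover have "ctheta s (1 - x) = ctheta s x" for s
      unfolding ctheta_def using cos_int_2pin sin_int_2pin
      by (intro infsum_cong) (simp add: right_diff_distrib cos_diff)
    ultimately show "theta t (1 - x) - ctheta (1 / t) (1 - x) / sqrt t = theta t x - ctheta (1 / t) x / sqrt t"
      by simp
  next
    fix n :: int
    have "integral {0..1} (\<lambda>x. (theta t x - ctheta (1 / t) x / sqrt t) * cos (2 * pi * of_int n * x)) =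
       integral {0..1} (\<lambda>x. theta t x * cos (2 * pi * of_int n * x) - ctheta (1 / t) x * cos (2 * pi * of_int n * x) / sqrt t)"
      by (simp add: algebra_simps)
    also have "\<dots> = integral {0..1} (\<lambda>x. theta t x * cos (2 * pi * of_int n * x))
        - integral {0..1} (\<lambda>x. ctheta (1 / t) x * cos (2 * pi * of_int n * x)) / sqrt t"
      using t by (subst integral_diff)
        (auto intro!: integrable_continuous_interval continuous_intros theta_Fourier ctheta_Fourier t')
    also have "\<dots> = 0"
      by (simp add: theta_Fourier(2)[OF t] ctheta_Fourier(2)[OF t'])
    finally show "integral {0..1} (\<lambda>x. (theta t x - ctheta (1 / t) x / sqrt t) * cos (2 * pi * of_int n * x)) = 0" .
  qed
  then show ?thesis using t by (simp add: field_simps)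
qed

section \<open>Lattice identities between theta constants\<close>

text \<open>For real families summability is absolute summability, which supplies the summability
  over the product set that iterated summation requires.\<close>

lemma has_sum_mult_Times:
  fixes f :: "'a \<Rightarrow> real" and g :: "'b \<Rightarrow> real"
  assumes f: "(f has_sum F) A" and g: "(g has_sum G) B"
  shows "((\<lambda>(x, y). f x * g y) has_sum F * G) (A \<times> B)"
proof (rule has_sum_SigmaI)
  show "((\<lambda>y. case (x, y) of (x, y) \<Rightarrow> f x * g y) has_sum f x * G) B" for x
    using g by (auto intro: has_sum_cmult_right)
  show "((\<lambda>x. f x * G) has_sum F * G) A"
    by (rule has_sum_cmult_left[OF f])
  have f': "(\<lambda>x. norm (f x)) summable_on A" and g': "(\<lambda>x. norm (g x)) summable_on B"
    using f g summable_on_iff_abs_summable_on_real has_sum_imp_summable by blast+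
  have "(\<lambda>z. norm (case z of (x, y) \<Rightarrow> f x * g y)) summable_on A \<times> B"
  proof (rule summable_on_SigmaI)
    show "((\<lambda>y. norm (case (x, y) of (x, y) \<Rightarrow> f x * g y)) has_sum norm (f x) * (\<Sum>\<^sub>\<infinity>y\<in>B. norm (g y))) B" for x
      using has_sum_cmult_right[OF has_sum_infsum[OF g'], of "norm (f x)"] by (simp add: abs_mult)
    show "(\<lambda>x. norm (f x) * (\<Sum>\<^sub>\<infinity>y\<in>B. norm (g y))) summable_on A"
      by (rule summable_on_cmult_left[OF f'])
  qed auto
  then show "(\<lambda>(x, y). f x * g y) summable_on A \<times> B"
    by (rule Infinite_Sum.abs_summable_summable)
qed

text \<open>Jacobi's theta constants with nome \<open>exp (- pi * t)\<close>.\<close>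

abbreviation "\<theta>2 t \<equiv> theta t (1 / 2)"
abbreviation "\<theta>3 t \<equiv> theta t 0"
abbreviation "\<theta>4 t \<equiv> ctheta t (1 / 2)"

definition parity_sign :: "int \<Rightarrow> real" where
  "parity_sign n = (if even n then 1 else - 1)"

lemma abs_parity_sign [simp]: "\<bar>parity_sign n\<bar> = 1"
  by (simp add: parity_sign_def)

lemma cos_pi_int: "cos (pi * of_int n) = parity_sign n"
  by (auto simp: parity_sign_def)

lemma \<theta>3_has_sum:
  assumes "t > 0"
  shows "((\<lambda>k::int. exp (- (pi * t * (of_int k)\<^sup>2))) has_sum \<theta>3 t) UNIV"
  using theta_has_sum[OF assms, of 0] by simp

lemma \<theta>4_has_sum:
  assumes "t > 0"
  shows "((\<lambda>k::int. exp (- (pi * t * (of_int k)\<^sup>2)) * parity_sign k) has_sum \<theta>4 t) UNIV"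
proof -
  have "cos (2 * pi * of_int k * (1 / 2)) = parity_sign k" for k :: int
    using cos_pi_int[of k] by simp
  then show ?thesis using ctheta_has_sum[OF assms, of "1 / 2"] by presburger
qed

section \<open>Splitting the square lattice by the parity of the coordinate sum\<close>

lemma range_parity_maps:
  "range (\<lambda>(s, u). (s + u, s - u)) = {(x, y). even (x + y :: int)}"
  "range (\<lambda>(s, u). (s + u + 1, s - u)) = {(x, y). odd (x + y :: int)}"
proof (safe)
  fix x y :: int
  assume "even (x + y)"
  then obtain s where "x + y = 2 * s" by blast
  then have "(x, y) = (\<lambda>(s, u). (s + u, s - u)) (s, x - s)" by simp
  then show "(x, y) \<in> range (\<lambda>(s, u). (s + u, s - u))" by blast
next
  fix x y :: int
  assume "odd (x + y)"
  then obtain s where "x + y = 2 * s + 1" by (rule oddE)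
  then have "(x, y) = (\<lambda>(s, u). (s + u + 1, s - u)) (s, x - s - 1)" by simp
  then show "(x, y) \<in> range (\<lambda>(s, u). (s + u + 1, s - u))" by blast
qed auto

lemma has_sum_parity_maps:
  fixes f :: "int \<times> int \<Rightarrow> real"
  shows "((\<lambda>(s, u). f (s + u, s - u)) has_sum A) UNIV \<longleftrightarrow> (f has_sum A) {(x, y). even (x + y)}"
    and "((\<lambda>(s, u). f (s + u + 1, s - u)) has_sum A) UNIV \<longleftrightarrow> (f has_sum A) {(x, y). odd (x + y)}"
  unfolding range_parity_maps[symmetric]
  by (subst has_sum_reindex; auto simp: inj_on_def o_def case_prod_unfold)+

text \<open>The substitution (s + u, s - u) doubles the norm x^2 + y^2 and thus replaces t by 2 * t.
  On the odd class it does the same after shifting both \<open>s\<close> and \<open>u\<close> by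
  1/2, which is how \<open>\<theta>2\<close> enters.\<close>

lemma has_sum_parity_split:
  fixes f :: "int \<times> int \<Rightarrow> real"
  assumes "((\<lambda>(s, u). f (s + u, s - u)) has_sum A) UNIV"
    and "((\<lambda>(s, u). f (s + u + 1, s - u)) has_sum B) UNIV"
  shows "(f has_sum A + B) UNIV"
proof -
  have "(f has_sum A + B) ({(x, y). even (x + y)} \<union> {(x, y). odd (x + y)})"
    using assms unfolding has_sum_parity_maps by (rule has_sum_Un_disjoint) auto
  also have "{(x, y). even (x + y)} \<union> {(x, y). odd (x + y)} = (UNIV :: (int \<times> int) set)" by auto
  finally show ?thesis .
qed

text \<open>The converse splitting, for a double series whose two parity parts have no closed
  form.\<close>

lemma has_sum_parity_splitE:
  fixes f :: "int \<times> int \<Rightarrow> real"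
  assumes "(f has_sum S) UNIV"
  obtains A B where "((\<lambda>(s, u). f (s + u, s - u)) has_sum A) UNIV"
    "((\<lambda>(s, u). f (s + u + 1, s - u)) has_sum B) UNIV" "S = A + B"
proof -
  have "f summable_on X" for X
    using assms by (meson has_sum_imp_summable subset_UNIV summable_on_subset)
  then obtain A B where "((\<lambda>(s, u). f (s + u, s - u)) has_sum A) UNIV"
    "((\<lambda>(s, u). f (s + u + 1, s - u)) has_sum B) UNIV"
    unfolding has_sum_parity_maps by (meson has_sum_infsum)
  with has_sum_parity_split[OF this] show ?thesis
    using has_sum_unique[OF assms] that by blast
qed

section \<open>Duplication formulas for the theta constants\<close>

lemma \<theta>3_square:
  assumes "t > 0"
  shows "(\<theta>3 t)\<^sup>2 = (\<theta>3 (2 * t))\<^sup>2 + (\<theta>2 (2 * t))\<^sup>2"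
proof -
  have t: "2 * t > 0" using assms by simp
  have "((\<lambda>(x::int, y::int). exp (- (pi * t * (of_int x)\<^sup>2)) * exp (- (pi * t * (of_int y)\<^sup>2))) has_sum
      \<theta>3 (2 * t) * \<theta>3 (2 * t) + \<theta>2 (2 * t) * \<theta>2 (2 * t)) UNIV"
  proof (rule has_sum_parity_split, goal_cases)
    case 1
    from has_sum_mult_Times[OF \<theta>3_has_sum[OF t] \<theta>3_has_sum[OF t]] show ?case
      by (simp add: exp_add[symmetric] power2_eq_square algebra_simps)
  next
    case 2
    from has_sum_mult_Times[OF theta_has_sum[OF t, of "1/2"] theta_has_sum[OF t, of "1/2"]] show ?case
      by (simp add: exp_add[symmetric] power2_eq_square algebra_simps)
  qed
  from has_sum_unique[OF this has_sum_mult_Times[OF \<theta>3_has_sum[OF assms] \<theta>3_has_sum[OF assms], unfolded UNIV_Times_UNIV]]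
  show ?thesis by (simp add: power2_eq_square)
qed

text \<open>The sign of x + y is constant on each parity class, so only the odd part of the formula
  for \<open>\<theta>3\<close> changes sign.\<close>

lemma \<theta>4_square:
  assumes "t > 0"
  shows "(\<theta>4 t)\<^sup>2 = (\<theta>3 (2 * t))\<^sup>2 - (\<theta>2 (2 * t))\<^sup>2"
proof -
  have t: "2 * t > 0" using assms by simp
  have "((\<lambda>(x::int, y::int). exp (- (pi * t * (of_int x)\<^sup>2)) * parity_sign x *
      (exp (- (pi * t * (of_int y)\<^sup>2)) * parity_sign y)) has_sum
      \<theta>3 (2 * t) * \<theta>3 (2 * t) + - (\<theta>2 (2 * t) * \<theta>2 (2 * t))) UNIV"
  proof (rule has_sum_parity_split, goal_cases)
    case 1
    have "exp (- (pi * t * (of_int (s + u))\<^sup>2)) * parity_sign (s + u) *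
        (exp (- (pi * t * (of_int (s - u))\<^sup>2)) * parity_sign (s - u)) =
      exp (- (pi * (2 * t) * (of_int s)\<^sup>2)) * exp (- (pi * (2 * t) * (of_int u)\<^sup>2))" for s u :: int
      by (simp add: parity_sign_def exp_add[symmetric] power2_eq_square algebra_simps)
    with has_sum_mult_Times[OF \<theta>3_has_sum[OF t] \<theta>3_has_sum[OF t]] show ?case by simp
  next
    case 2
    have "exp (- (pi * t * (of_int (s + u + 1))\<^sup>2)) * parity_sign (s + u + 1) *
        (exp (- (pi * t * (of_int (s - u))\<^sup>2)) * parity_sign (s - u)) =
      - (exp (- (pi * (2 * t) * (of_int s + 1 / 2)\<^sup>2)) * exp (- (pi * (2 * t) * (of_int u + 1 / 2)\<^sup>2)))" for s u :: int
      by (simp add: parity_sign_def exp_add[symmetric] power2_eq_square algebra_simps)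
    with has_sum_mult_Times[OF theta_has_sum[OF t, of "1/2"] theta_has_sum[OF t, of "1/2"]] show ?case
      by (simp add: has_sum_uminus case_prod_unfold)
  qed
  from has_sum_unique[OF this has_sum_mult_Times[OF \<theta>4_has_sum[OF assms] \<theta>4_has_sum[OF assms], unfolded UNIV_Times_UNIV]]
  show ?thesis by (simp add: power2_eq_square)
qed

text \<open>The reflection k -> -1 - k preserves (k + 1/2)^2 and reverses the parity of
  \<open>k\<close>, so the sum equals its negative. This is the vanishing of Jacobi's first theta
  function at the origin.\<close>

lemma signed_half_shift_has_sum_0:
  assumes "t > 0"
  shows "((\<lambda>k::int. exp (- (pi * t * (of_int k + 1 / 2)\<^sup>2)) * parity_sign k) has_sum 0) UNIV"
proof -
  let ?f = "\<lambda>k::int. exp (- (pi * t * (of_int k + 1 / 2)\<^sup>2)) * parity_sign k"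
  have "(\<lambda>k. norm (?f k)) summable_on UNIV"
    using theta_summable[OF assms, of "1 / 2"] by (simp add: abs_mult)
  then have "?f summable_on UNIV" by (rule Infinite_Sum.abs_summable_summable)
  then have s: "(?f has_sum infsum ?f UNIV) UNIV" by (rule has_sum_infsum)
  have "infsum ?f UNIV = (\<Sum>\<^sub>\<infinity>k. - ?f k)"
    by (rule infsum_reindex_bij_witness[of _ "\<lambda>k. - 1 - k" "\<lambda>k. - 1 - k"])
      (auto simp: parity_sign_def power2_eq_square algebra_simps)
  then have "infsum ?f UNIV = 0" by (simp add: infsum_uminus)
  with s show ?thesis by simp
qed

text \<open>The sign of y factors as the sign of s times the sign of u. The even class therefore
  gives the square of \<open>\<theta>4\<close>, and the odd class is a product of two vanishing
  sums.\<close>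

lemma \<theta>3_mult_\<theta>4:
  assumes "t > 0"
  shows "\<theta>3 t * \<theta>4 t = (\<theta>4 (2 * t))\<^sup>2"
proof -
  have t: "2 * t > 0" using assms by simp
  have "((\<lambda>(x::int, y::int). exp (- (pi * t * (of_int x)\<^sup>2)) *
      (exp (- (pi * t * (of_int y)\<^sup>2)) * parity_sign y)) has_sum
      \<theta>4 (2 * t) * \<theta>4 (2 * t) + 0 * 0) UNIV"
  proof (rule has_sum_parity_split, goal_cases)
    case 1
    have "exp (- (pi * t * (of_int (s + u))\<^sup>2)) *
        (exp (- (pi * t * (of_int (s - u))\<^sup>2)) * parity_sign (s - u)) =
      exp (- (pi * (2 * t) * (of_int s)\<^sup>2)) * parity_sign s * (exp (- (pi * (2 * t) * (of_int u)\<^sup>2)) * parity_sign u)" for s u :: int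
      by (simp add: parity_sign_def exp_add[symmetric] power2_eq_square algebra_simps)
    with has_sum_mult_Times[OF \<theta>4_has_sum[OF t] \<theta>4_has_sum[OF t]] show ?case by simp
  next
    case 2
    have "exp (- (pi * t * (of_int (s + u + 1))\<^sup>2)) *
        (exp (- (pi * t * (of_int (s - u))\<^sup>2)) * parity_sign (s - u)) =
      exp (- (pi * (2 * t) * (of_int s + 1 / 2)\<^sup>2)) * parity_sign s * (exp (- (pi * (2 * t) * (of_int u + 1 / 2)\<^sup>2)) * parity_sign u)" for s u :: int
      by (simp add: parity_sign_def exp_add[symmetric] power2_eq_square algebra_simps)
    with has_sum_mult_Times[OF signed_half_shift_has_sum_0[OF t] signed_half_shift_has_sum_0[OF t]] show ?case by simp
  qed
  from has_sum_unique[OF this has_sum_mult_Times[OF \<theta>3_has_sum[OF assms] \<theta>4_has_sum[OF assms], unfolded UNIV_Times_UNIV]]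
  show ?thesis by (simp add: power2_eq_square)
qed

lemma \<theta>2_square:
  assumes "t > 0"
  shows "(\<theta>2 t)\<^sup>2 = 2 * \<theta>2 (2 * t) * \<theta>3 (2 * t)"
proof -
  have t: "2 * t > 0" using assms by simp
  have 1: "theta (2 * t) 1 = \<theta>3 (2 * t)" using theta_add_int[of "2 * t" 0 1] by simp
  have "((\<lambda>(x::int, y::int). exp (- (pi * t * (of_int x + 1 / 2)\<^sup>2)) * exp (- (pi * t * (of_int y + 1 / 2)\<^sup>2))) has_sum
      \<theta>2 (2 * t) * \<theta>3 (2 * t) + \<theta>3 (2 * t) * \<theta>2 (2 * t)) UNIV"
  proof (rule has_sum_parity_split, goal_cases)
    case 1
    from has_sum_mult_Times[OF theta_has_sum[OF t, of "1/2"] \<theta>3_has_sum[OF t]] show ?case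
      by (simp add: exp_add[symmetric] power2_eq_square algebra_simps)
  next
    case 2
    have "exp (- (pi * t * (of_int (s + u + 1) + 1 / 2)\<^sup>2)) * exp (- (pi * t * (of_int (s - u) + 1 / 2)\<^sup>2)) =
      exp (- (pi * (2 * t) * (of_int s + 1)\<^sup>2)) * exp (- (pi * (2 * t) * (of_int u + 1 / 2)\<^sup>2))" for s u :: int
      by (simp add: exp_add[symmetric] power2_eq_square algebra_simps)
    with has_sum_mult_Times[OF theta_has_sum[OF t, of 1] theta_has_sum[OF t, of "1/2"]] show ?case
      unfolding 1 by simp
  qed
  from has_sum_unique[OF this has_sum_mult_Times[OF theta_has_sum[OF assms, of "1/2"] theta_has_sum[OF assms, of "1/2"], unfolded UNIV_Times_UNIV]]
  show ?thesis by (simp add: power2_eq_square mult_ac)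
qed

text \<open>With a and b denoting \<open>\<theta>3\<close> and \<open>\<theta>2\<close> at 2 * t,
  the duplication formulas reduce the claim to (a^2 + b^2)^2 = (2 a b)^2 + (a^2 - b^2)^2.\<close>

theorem Jacobi_quartic:
  assumes "t > 0"
  shows "\<theta>3 t ^ 4 = \<theta>2 t ^ 4 + \<theta>4 t ^ 4"
proof -
  have "x ^ 4 = (x\<^sup>2)\<^sup>2" for x :: real by simp
  then have "\<theta>3 t ^ 4 - \<theta>4 t ^ 4 - \<theta>2 t ^ 4 = ((\<theta>3 t)\<^sup>2)\<^sup>2 - ((\<theta>4 t)\<^sup>2)\<^sup>2 - ((\<theta>2 t)\<^sup>2)\<^sup>2" by presburger
  also have "\<dots> = 0"
    unfolding \<theta>3_square[OF assms] \<theta>4_square[OF assms] \<theta>2_square[OF assms]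
    by (simp add: power2_eq_square algebra_simps)
  finally show ?thesis by simp
qed

text \<open>The integer points with odd coordinate sum and the two parity classes of half-integer points
  are the nonzero cosets of \<open>2L\<close> in the hexagonal lattice \<open>L\<close>; a rotation of \<open>L\<close> permutes them, so
  they contribute equally.\<close>

theorem theta_degree_3:
  assumes "t > 0"
  shows "\<theta>3 t * \<theta>3 (3 * t) = \<theta>4 t * \<theta>4 (3 * t) + \<theta>2 t * \<theta>2 (3 * t)"
proof -
  have t: "3 * t > 0" using assms by simp
  \<comment> \<open>With x = a + b and y = a - b, the form x^2 + 3 y^2 becomes 4 (a^2 - a b + b^2),
    which displays the hexagonal symmetry.\<close>
  define q where "q = (\<lambda>a b :: real. exp (- (pi * t * (4 * (a * a - a * b + b * b)))))"
  have "((\<lambda>(x::int, y::int). exp (- (pi * t * (of_int x)\<^sup>2)) * exp (- (pi * (3 * t) * (of_int y)\<^sup>2)))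
      has_sum \<theta>3 t * \<theta>3 (3 * t)) UNIV"
    using has_sum_mult_Times[OF \<theta>3_has_sum[OF assms] \<theta>3_has_sum[OF t]] by simp
  \<comment> \<open>The parts \<open>E\<close> and \<open>X\<close> are never evaluated: the three
    products of theta constants turn out to be E + X, E - X and 2 X.\<close>
  from has_sum_parity_splitE[OF this] obtain E X where
    E: "((\<lambda>(s, u). exp (- (pi * t * (of_int (s + u))\<^sup>2)) * exp (- (pi * (3 * t) * (of_int (s - u))\<^sup>2))) has_sum E) (UNIV :: (int \<times> int) set)"
    and X: "((\<lambda>(s, u). exp (- (pi * t * (of_int (s + u + 1))\<^sup>2)) * exp (- (pi * (3 * t) * (of_int (s - u))\<^sup>2))) has_sum X) (UNIV :: (int \<times> int) set)"
    and EX: "\<theta>3 t * \<theta>3 (3 * t) = E + X"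
    by auto
  have "exp (- (pi * t * (of_int (s + u + 1))\<^sup>2)) * exp (- (pi * (3 * t) * (of_int (s - u))\<^sup>2)) =
      q (of_int s + 1 / 2) (of_int u + 1 / 2)" for s u :: int
    unfolding q_def by (simp add: exp_add[symmetric] power2_eq_square algebra_simps)
  with X have X': "((\<lambda>(s, u). q (of_int s + 1 / 2) (of_int u + 1 / 2)) has_sum X) (UNIV :: (int \<times> int) set)"
    by simp
  have "((\<lambda>(x::int, y::int). exp (- (pi * t * (of_int x)\<^sup>2)) * parity_sign x *
      (exp (- (pi * (3 * t) * (of_int y)\<^sup>2)) * parity_sign y)) has_sum E + - X) UNIV"
  proof (rule has_sum_parity_split, goal_cases)
    case 1
    have eq: "exp (- (pi * t * (of_int (s + u))\<^sup>2)) * parity_sign (s + u) *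
        (exp (- (pi * (3 * t) * (of_int (s - u))\<^sup>2)) * parity_sign (s - u)) =
      exp (- (pi * t * (of_int (s + u))\<^sup>2)) * exp (- (pi * (3 * t) * (of_int (s - u))\<^sup>2))" for s u :: int
      by (simp add: parity_sign_def)
    show ?case unfolding prod.case eq by (rule E)
  next
    case 2
    have "exp (- (pi * t * (of_int (s + u + 1))\<^sup>2)) * parity_sign (s + u + 1) *
        (exp (- (pi * (3 * t) * (of_int (s - u))\<^sup>2)) * parity_sign (s - u)) =
      - (exp (- (pi * t * (of_int (s + u + 1))\<^sup>2)) * exp (- (pi * (3 * t) * (of_int (s - u))\<^sup>2)))" for s u :: int
      by (simp add: parity_sign_def)
    with X show ?case by (simp add: has_sum_uminus case_prod_unfold)
  qed
  from has_sum_unique[OF this has_sum_mult_Times[OF \<theta>4_has_sum[OF assms] \<theta>4_has_sum[OF t], unfolded UNIV_Times_UNIV]]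
  have 4: "\<theta>4 t * \<theta>4 (3 * t) = E - X" by simp
  have "((\<lambda>(x::int, y::int). exp (- (pi * t * (of_int x + 1 / 2)\<^sup>2)) * exp (- (pi * (3 * t) * (of_int y + 1 / 2)\<^sup>2)))
      has_sum X + X) UNIV"
  proof (rule has_sum_parity_split, goal_cases)
    case 1
    have "((\<lambda>(s, u). exp (- (pi * t * (of_int (s + u) + 1 / 2)\<^sup>2)) * exp (- (pi * (3 * t) * (of_int (s - u) + 1 / 2)\<^sup>2))) has_sum X)
        (UNIV :: (int \<times> int) set) \<longleftrightarrow> ((\<lambda>(s, u). q (of_int s + 1 / 2) (of_int u + 1 / 2)) has_sum X) (UNIV :: (int \<times> int) set)"
      \<comment> \<open>Here a = s + 1/2 and b = u. The symmetry (a, b) -> (a, a - b) of the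
        hexagonal form makes both coordinates half-integers.\<close>
      by (rule has_sum_reindex_bij_witness[where i = "\<lambda>(s, u). (s, s - u)" and j = "\<lambda>(s, u). (s, s - u)"])
        (auto simp: q_def exp_add[symmetric] power2_eq_square algebra_simps)
    with X' show ?case by simp
  next
    case 2
    have "((\<lambda>(s, u). exp (- (pi * t * (of_int (s + u + 1) + 1 / 2)\<^sup>2)) * exp (- (pi * (3 * t) * (of_int (s - u) + 1 / 2)\<^sup>2))) has_sum X)
        (UNIV :: (int \<times> int) set) \<longleftrightarrow> ((\<lambda>(s, u). q (of_int s + 1 / 2) (of_int u + 1 / 2)) has_sum X) (UNIV :: (int \<times> int) set)"
      \<comment> \<open>Here a = s + 1 and b = u + 1/2. The symmetry (a, b) -> (b, b - a), a
        rotation of order six, does the same.\<close>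
      by (rule has_sum_reindex_bij_witness[where i = "\<lambda>(s, u). (s - u - 1, s)" and j = "\<lambda>(s, u). (u, u - s - 1)"])
        (auto simp: q_def exp_add[symmetric] power2_eq_square algebra_simps)
    with X' show ?case by simp
  qed
  from has_sum_unique[OF this has_sum_mult_Times[OF theta_has_sum[OF assms, of "1/2"] theta_has_sum[OF t, of "1/2"], unfolded UNIV_Times_UNIV]]
  have "\<theta>2 t * \<theta>2 (3 * t) = 2 * X" by simp
  with EX 4 show ?thesis by simp
qed

text \<open>The coefficient vectors of \<open>k1, ..., k4\<close>, namely \<open>(1, 1, 1, 0)\<close>, \<open>(1, -1, 0, 1)\<close>, \<open>(1, 0, -1, -1)\<close>, \<open>(0, 1, -1, 1)\<close>,
  are orthogonal of norm \<open>3\<close>;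
  the vectors \<open>(c, d, 0, 0)\<close> represent the nine cosets of the lattice that they span.\<close>

definition tetracode_map :: "(int \<times> int) \<times> (int \<times> int \<times> int \<times> int) \<Rightarrow> int \<times> int \<times> int \<times> int" where
  "tetracode_map = (\<lambda>((c, d), (k1, k2, k3, k4)). (k1 + k2 + k3 + c, k1 - k2 + k4 + d, k1 - k3 - k4, k2 - k3 + k4))"

text \<open>The combinations x1 - x3 - x4 and x2 - x3 + x4 of an image point equal 3 * k3 + c and 3
  * k4 + d. Division with remainder by 3 therefore recovers the coset and two coordinates, and x3
  and x4 then determine k1 and k2.\<close>

lemma bij_betw_tetracode_map:
  "bij_betw tetracode_map (({0..2} \<times> {0..2}) \<times> UNIV) UNIV"
proof (rule bij_betwI)
  let ?g = "\<lambda>(x1, x2, x3, x4). let y3 = x1 - x3 - x4; y4 = x2 - x3 + x4 in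
    ((y3 mod 3, y4 mod 3), (y3 div 3 + y4 div 3 + x3, y3 div 3 - y4 div 3 + x4, y3 div 3, y4 div 3)) ::
    (int \<times> int) \<times> (int \<times> int \<times> int \<times> int)"
  show "?g \<in> UNIV \<rightarrow> ({0..2} \<times> {0..2}) \<times> UNIV"
  proof -
    have "x mod 3 \<in> {0..2}" for x :: int
      using pos_mod_bound[of 3 x] pos_mod_sign[of 3 x] by simp
    then show ?thesis by (simp add: Let_def split_beta del: atLeastAtMost_iff)
  qed
  show "?g (tetracode_map z) = z" if "z \<in> ({0..2} \<times> {0..2}) \<times> UNIV" for z
  proof -
    obtain c d k1 k2 k3 k4 where z: "z = ((c, d), (k1, k2, k3, k4))" by (metis surj_pair)
    with that have "c \<in> {0..2}" "d \<in> {0..2}" by auto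
    then have "(3 * k3 + c) div 3 = k3" "(3 * k3 + c) mod 3 = c" "(3 * k4 + d) div 3 = k4" "(3 * k4 + d) mod 3 = d"
      by auto
    moreover have "k1 + k2 + k3 + c - (k1 - k3 - k4) - (k2 - k3 + k4) = 3 * k3 + c"
      "k1 - k2 + k4 + d - (k1 - k3 - k4) + (k2 - k3 + k4) = 3 * k4 + d" by simp_all
    ultimately show ?thesis by (simp add: z tetracode_map_def Let_def)
  qed
  show "tetracode_map (?g x) = x" for x
  proof -
    obtain x1 x2 x3 x4 where x: "x = (x1, x2, x3, x4)" by (metis surj_pair)
    define y3 y4 where "y3 = x1 - x3 - x4" and "y4 = x2 - x3 + x4"
    have "3 * (y3 div 3) + y3 mod 3 = y3" "3 * (y4 div 3) + y4 mod 3 = y4" by simp_all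
    then show ?thesis
      unfolding x tetracode_map_def by (auto simp: Let_def y3_def[symmetric] y4_def[symmetric]) (auto simp: y3_def y4_def)
  qed
qed auto

text \<open>Orthogonality makes the sum over each coset a product of four theta values. For (c, d)
  nonzero modulo 3, exactly one of c + d, c - d, c, d is divisible by 3: nonzero words of the
  tetracode have weight three. So all eight nontrivial cosets contribute alike.\<close>

theorem theta_tetracode:
  assumes "t > 0"
  shows "\<theta>3 t ^ 4 = \<theta>3 (3 * t) ^ 4 + 8 * \<theta>3 (3 * t) * theta (3 * t) (1 / 3) ^ 3"
proof -
  have t: "3 * t > 0" using assms by simp
  define g where "g = (\<lambda>b (k::int). exp (- (pi * (3 * t) * (of_int k + b)\<^sup>2)))"
  define e where "e = (\<lambda>k::int. exp (- (pi * t * (of_int k)\<^sup>2)))"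
  \<comment> \<open>The offsets are the inner products of (c, d, 0, 0) with the four spanning
    vectors, divided by their norm 3.\<close>
  define T where "T = (\<lambda>(c::int, d::int). theta (3 * t) ((c + d) / 3) * (theta (3 * t) ((c - d) / 3) *
      (theta (3 * t) (c / 3) * theta (3 * t) (d / 3))))"
  have g: "(g b has_sum theta (3 * t) b) UNIV" for b
    unfolding g_def by (rule theta_has_sum[OF t])
  have e: "(e has_sum \<theta>3 t) UNIV"
    unfolding e_def by (rule \<theta>3_has_sum[OF assms])
  have "((\<lambda>(x1, x2, x3, x4). e x1 * (e x2 * (e x3 * e x4))) has_sum \<theta>3 t * (\<theta>3 t * (\<theta>3 t * \<theta>3 t))) UNIV"
    using has_sum_mult_Times[OF e has_sum_mult_Times[OF e has_sum_mult_Times[OF e e]]]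
    by (simp add: case_prod_unfold)
  then have "((\<lambda>z. case tetracode_map z of (x1, x2, x3, x4) \<Rightarrow> e x1 * (e x2 * (e x3 * e x4))) has_sum
      \<theta>3 t * (\<theta>3 t * (\<theta>3 t * \<theta>3 t))) (({0..2} \<times> {0..2}) \<times> UNIV)"
    by (subst has_sum_reindex_bij_betw[OF bij_betw_tetracode_map])
  moreover have "((\<lambda>k. case tetracode_map (cd, k) of (x1, x2, x3, x4) \<Rightarrow> e x1 * (e x2 * (e x3 * e x4))) has_sum T cd) UNIV"
    for cd
  proof -
    obtain c d where cd: "cd = (c, d)" by fastforce
    have eq: "(case tetracode_map (cd, k) of (x1, x2, x3, x4) \<Rightarrow> e x1 * (e x2 * (e x3 * e x4))) =
       (case k of (k1, k2, k3, k4) \<Rightarrow> g ((c + d) / 3) k1 * (g ((c - d) / 3) k2 * (g (c / 3) k3 * g (d / 3) k4)))" for k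
    proof -
      obtain k1 k2 k3 k4 where k: "k = (k1, k2, k3, k4)" by (metis surj_pair)
      show ?thesis
        unfolding cd k e_def g_def tetracode_map_def prod.case exp_add[symmetric]
        by (rule arg_cong[where f = exp]) (simp add: power2_eq_square field_simps)
    qed
    show ?thesis
      unfolding eq
      using has_sum_mult_Times[OF g has_sum_mult_Times[OF g has_sum_mult_Times[OF g g]]]
      by (simp add: case_prod_unfold T_def cd)
  qed
  ultimately have "(T has_sum \<theta>3 t * (\<theta>3 t * (\<theta>3 t * \<theta>3 t))) ({0..2} \<times> {0..2})"
    by (rule has_sum_SigmaD)
  moreover have "(T has_sum sum T ({0..2} \<times> {0..2})) ({0..2} \<times> {0..2})" by (intro has_sum_finite) auto
  ultimately have "\<theta>3 t * (\<theta>3 t * (\<theta>3 t * \<theta>3 t)) = sum T ({0..2} \<times> {0..2})"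
    by (rule has_sum_unique)
  moreover have "{0..2::int} = {0, 1, 2}" by auto
  moreover have "theta (3 * t) (2 / 3) = theta (3 * t) (1 / 3)" "theta (3 * t) (- (1 / 3)) = theta (3 * t) (1 / 3)"
      "theta (3 * t) 1 = \<theta>3 (3 * t)" "theta (3 * t) (4 / 3) = theta (3 * t) (1 / 3)"
      "theta (3 * t) (- (2 / 3)) = theta (3 * t) (1 / 3)"
    using theta_add_int[of "3 * t" "- 1 / 3" 1] theta_neg[of "3 * t" "1 / 3"] theta_add_int[of "3 * t" 0 1]
      theta_add_int[of "3 * t" "1 / 3" 1] theta_neg[of "3 * t" "2 / 3"] by simp_all
  ultimately show ?thesis
    unfolding sum.cartesian_product' by (simp add: T_def power4_eq_xxxx power3_eq_cube)
qed

text \<open>Summing over the three shifts by thirds keeps only the frequencies divisible by 3;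
  writing n = 3 m turns t into 9 * t and b into 3 * b.\<close>

lemma ctheta_trisection:
  assumes "t > 0"
  shows "ctheta t b + ctheta t (b + 1 / 3) + ctheta t (b - 1 / 3) = 3 * ctheta (9 * t) (3 * b)"
proof -
  define f where "f = (\<lambda>n::int. exp (- (pi * t * (of_int n)\<^sup>2)) * cos (2 * pi * of_int n * b) +
    exp (- (pi * t * (of_int n)\<^sup>2)) * cos (2 * pi * of_int n * (b + 1 / 3)) +
    exp (- (pi * t * (of_int n)\<^sup>2)) * cos (2 * pi * of_int n * (b - 1 / 3)))"
  have c3: "1 + 2 * cos (2 * pi * of_int n / 3) = (if 3 dvd n then 3 else 0)" for n :: int
  proof -
    consider "n mod 3 = 0" | "n mod 3 = 1" | "n mod 3 = 2" by linarith
    then consider m where "n = 3 * m" | m where "n = 3 * m + 1" | m where "n = 3 * m - 1"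
    proof cases
      case 3
      then have "n = 3 * (n div 3 + 1) - 1" by presburger
      with that(3) show ?thesis by blast
    qed (use mult_div_mod_eq[of 3 n] that(1,2)[of "n div 3"] in auto)
    then show ?thesis
    proof cases
      case 1
      then have "2 * pi * of_int n / 3 = 2 * pi * of_int m" by simp
      with 1 show ?thesis by (simp only: cos_int_2pin) simp
    next
      case (2 m)
      then have "real_of_int n = 3 * of_int m + 1" by simp
      then have "2 * pi * of_int n / 3 = 2 * pi * of_int m + 2 * pi / 3"
        by (simp only:) (simp add: field_simps)
      moreover have "\<not> 3 dvd n" using 2 by presburger
      ultimately show ?thesis by (simp only: cos_add cos_int_2pin sin_int_2pin) (simp add: cos_120)
    next
      case (3 m)
      then have "real_of_int n = 3 * of_int m - 1" by simp
      then have "2 * pi * of_int n / 3 = 2 * pi * of_int m - 2 * pi / 3"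
        by (simp only:) (simp add: field_simps)
      moreover have "\<not> 3 dvd n" using 3 by presburger
      ultimately show ?thesis by (simp only: cos_diff cos_int_2pin sin_int_2pin) (simp add: cos_120)
    qed
  qed
  have "f n = (if 3 dvd n then 3 * (exp (- (pi * t * (of_int n)\<^sup>2)) * cos (2 * pi * of_int n * b)) else 0)" for n
  proof -
    have "cos (2 * pi * of_int n * b) + cos (2 * pi * of_int n * (b + 1 / 3)) + cos (2 * pi * of_int n * (b - 1 / 3)) =
      cos (2 * pi * of_int n * b) * (1 + 2 * cos (2 * pi * of_int n / 3))"
      by (simp add: algebra_simps cos_add cos_diff)
    then show ?thesis unfolding f_def distrib_left[symmetric] c3 by simp
  qed
  moreover have "(f has_sum ctheta t b + ctheta t (b + 1 / 3) + ctheta t (b - 1 / 3)) UNIV"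
    unfolding f_def by (intro has_sum_add ctheta_has_sum assms)
  ultimately have "((\<lambda>n. 3 * (exp (- (pi * t * (of_int n)\<^sup>2)) * cos (2 * pi * of_int n * b))) has_sum
      ctheta t b + ctheta t (b + 1 / 3) + ctheta t (b - 1 / 3)) {n. 3 dvd n}"
    by (subst has_sum_cong_neutral[where g = f and T = UNIV]) auto
  also have "{n. 3 dvd n} = range ((*) (3::int))" by auto
  finally have "((\<lambda>n::int. 3 * (exp (- (pi * t * (of_int (3 * n))\<^sup>2)) * cos (2 * pi * of_int (3 * n) * b))) has_sum
      ctheta t b + ctheta t (b + 1 / 3) + ctheta t (b - 1 / 3)) UNIV"
    by (subst (asm) has_sum_reindex) (auto simp: inj_on_def o_def)
  moreover have "((\<lambda>n::int. 3 * (exp (- (pi * (9 * t) * (of_int n)\<^sup>2)) * cos (2 * pi * of_int n * (3 * b)))) has_sum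
      3 * ctheta (9 * t) (3 * b)) UNIV"
    using assms by (intro has_sum_cmult_right ctheta_has_sum) auto
  moreover have "3 * (exp (- (pi * t * (of_int (3 * n))\<^sup>2)) * cos (2 * pi * of_int (3 * n) * b)) =
    3 * (exp (- (pi * (9 * t) * (of_int n)\<^sup>2)) * cos (2 * pi * of_int n * (3 * b)))" for n :: int
    by (simp add: power_mult_distrib mult_ac)
  ultimately show ?thesis
    using has_sum_unique by (simp only:)
qed

section \<open>Gauss' arithmetic-geometric mean integral\<close>

text \<open>For a nonnegative integrand, integrability is absolute integrability. The change of
  variables then becomes an equivalence that also transports existence of the integral, over
  unbounded sets too.\<close>

lemma has_integral_substitution_nonneg:
  fixes f g :: "real \<Rightarrow> real"
  assumes "S \<in> sets lebesgue"
    and "\<And>x. x \<in> S \<Longrightarrow> (g has_field_derivative g' x) (at x within S)"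
    and "inj_on g S"
    and nonneg: "\<And>y. f y \<ge> 0"
  shows "(f has_integral I) (g ` S) \<longleftrightarrow> ((\<lambda>x. \<bar>g' x\<bar> * f (g x)) has_integral I) S"
proof -
  have "(f has_integral I) (g ` S) \<longleftrightarrow> f absolutely_integrable_on g ` S \<and> integral (g ` S) f = I"
    using nonnegative_absolutely_integrable_1[of f] nonneg
      set_lebesgue_integral_eq_integral(1)[of "g ` S" f] by (auto simp: has_integral_iff)
  moreover have "((\<lambda>x. \<bar>g' x\<bar> * f (g x)) has_integral I) S \<longleftrightarrow>
      (\<lambda>x. \<bar>g' x\<bar> * f (g x)) absolutely_integrable_on S \<and> integral S (\<lambda>x. \<bar>g' x\<bar> * f (g x)) = I"
    using nonnegative_absolutely_integrable_1[of "\<lambda>x. \<bar>g' x\<bar> * f (g x)" S] nonneg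
      set_lebesgue_integral_eq_integral(1)[of S "\<lambda>x. \<bar>g' x\<bar> * f (g x)"] by (auto simp: has_integral_iff)
  ultimately show ?thesis
    using has_absolute_integral_change_of_variables_1'[OF assms(1-3), of f I] by simp
qed

text \<open>Integrand of a complete elliptic integral in algebraic form. For positive parameters its
  integral over the line is pi divided by their arithmetic-geometric mean.\<close>

definition agm_fun :: "real \<Rightarrow> real \<Rightarrow> real \<Rightarrow> real" where
  "agm_fun a b x = 1 / sqrt ((x\<^sup>2 + a\<^sup>2) * (x\<^sup>2 + b\<^sup>2))"

lemma agm_fun_nonneg [simp]: "agm_fun a b x \<ge> 0"
  by (simp add: agm_fun_def)

lemma agm_fun_even [simp]: "agm_fun a b (- x) = agm_fun a b x"
  by (simp add: agm_fun_def)

lemma even_has_integral_UNIV: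
  fixes f :: "real \<Rightarrow> real"
  assumes f: "(f has_integral I) {0<..}" and even: "\<And>x. f (- x) = f x" and nonneg: "\<And>x. f x \<ge> 0"
  shows "(f has_integral 2 * I) UNIV"
proof -
  have n: "negligible {x \<in> {0::real<..} - {0..}. f x \<noteq> 0}" "negligible {x \<in> {0..} - {0::real<..}. f x \<noteq> 0}"
    by (auto intro: negligible_subset[of "{0}"])
  have 1: "(f has_integral I) {0..}"
    using f has_integral_spike_set_eq[OF n] by blast
  have "(f has_integral I) (uminus ` {0..})"
    by (subst has_integral_substitution_nonneg[where g' = "\<lambda>_. - 1"])
      (use 1 in \<open>auto intro!: derivative_eq_intros simp: even nonneg\<close>)
  then have 2: "(f has_integral I) {..0}" by simp
  have "(f has_integral I + I) ({0..} \<union> {..0})"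
    by (rule has_integral_Un[OF 1 2]) (auto intro: negligible_subset[of "{0}"])
  moreover have "{0..} \<union> {..0} = (UNIV :: real set)" by auto
  ultimately show ?thesis by simp
qed

lemma even_has_integral_half:
  fixes f :: "real \<Rightarrow> real"
  assumes f: "(f has_integral I) UNIV" and even: "\<And>x. f (- x) = f x" and nonneg: "\<And>x. f x \<ge> 0"
  shows "(f has_integral I / 2) {0<..}"
proof -
  have "f absolutely_integrable_on UNIV"
    using f nonneg by (intro nonnegative_absolutely_integrable_1) (auto simp: has_integral_iff)
  then have "f absolutely_integrable_on {0<..}"
    by (rule set_integrable_subset) auto
  then obtain J where J: "(f has_integral J) {0<..}"
    using set_lebesgue_integral_eq_integral(1) by blast
  with even_has_integral_UNIV[OF J even nonneg] f have "I = 2 * J"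
    using has_integral_unique by blast
  with J show ?thesis by simp
qed

lemma agm_step_surj:
  assumes "p > 0"
  shows "(\<lambda>t. (t - p / t) / 2) ` {0<..} = (UNIV :: real set)"
proof -
  have "y \<in> (\<lambda>t. (t - p / t) / 2) ` {0<..}" for y
  proof
    \<comment> \<open>The positive root of t^2 - 2 y t - p = 0.\<close>
    define t where "t = y + sqrt (y\<^sup>2 + p)"
    have "\<bar>y\<bar> < sqrt (y\<^sup>2 + p)" using assms by (intro real_less_rsqrt) simp
    then show "t \<in> {0<..}" by (simp add: t_def)
    have "(sqrt (y\<^sup>2 + p))\<^sup>2 = y\<^sup>2 + p" using assms by (intro real_sqrt_pow2) auto
    then have "t * t - p = 2 * y * t"
      unfolding t_def power2_eq_square by (simp add: algebra_simps)
    then show "y = (t - p / t) / 2" using \<open>t \<in> {0<..}\<close> by (simp add: field_simps)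
  qed
  then show ?thesis by auto
qed

text \<open>Gauss' substitution \<open>u = (t - a b / t) / 2\<close>.\<close>

lemma agm_integral_step:
  assumes a: "a > 0" and b: "b > 0" and c: "c \<ge> 0" "c\<^sup>2 = a * b"
  shows "(agm_fun a b has_integral I) UNIV \<longleftrightarrow> (agm_fun ((a + b) / 2) c has_integral I) UNIV"
proof -
  let ?g = "\<lambda>t. (t - a * b / t) / 2"
  have p: "a * b > 0" using a b by simp
  have "inj_on ?g {0<..}"
  proof (rule inj_onI)
    fix s t :: real assume st: "s \<in> {0<..}" "t \<in> {0<..}" "?g s = ?g t"
    then have "(s - t) * (1 + a * b / (s * t)) = 0" by (simp add: field_simps)
    moreover have "1 + a * b / (s * t) > 0" using p st by (simp add: add_pos_pos)
    ultimately show "s = t" by simp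
  qed
  moreover have "(?g has_field_derivative (1 + a * b / t\<^sup>2) / 2) (at t within {0<..})" if "t \<in> {0<..}" for t
    using that by (auto intro!: derivative_eq_intros simp: field_simps power2_eq_square)
  ultimately have "(agm_fun ((a + b) / 2) c has_integral I) UNIV \<longleftrightarrow>
      ((\<lambda>t. \<bar>(1 + a * b / t\<^sup>2) / 2\<bar> * agm_fun ((a + b) / 2) c (?g t)) has_integral I) {0<..}"
    unfolding agm_step_surj[OF p, symmetric]
    by (intro has_integral_substitution_nonneg) auto
  also have "\<dots> \<longleftrightarrow> ((\<lambda>t. 2 * agm_fun a b t) has_integral I) {0<..}"
  proof (rule has_integral_cong)
    fix t :: real assume "t \<in> {0<..}"
    then have t: "t > 0" by simp
    \<comment> \<open>The quantity w / 2 is the square root of u^2 + c^2, and w / (2 t) is the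
      derivative of the substitution, so \<open>w\<close> cancels.\<close>
    define w where "w = t + a * b / t"
    have w: "w > 0" using t p by (simp add: w_def add_pos_pos)
    have 1: "(?g t)\<^sup>2 + ((a + b) / 2)\<^sup>2 = (t\<^sup>2 + a\<^sup>2) * (t\<^sup>2 + b\<^sup>2) / (2 * t)\<^sup>2"
      using t by (simp add: power2_eq_square field_simps)
    have 2: "(?g t)\<^sup>2 + c\<^sup>2 = (w / 2)\<^sup>2"
      using t unfolding c(2) by (simp add: w_def power2_eq_square field_simps)
    have "sqrt (((?g t)\<^sup>2 + ((a + b) / 2)\<^sup>2) * ((?g t)\<^sup>2 + c\<^sup>2)) = sqrt ((t\<^sup>2 + a\<^sup>2) * (t\<^sup>2 + b\<^sup>2)) / (2 * t) * (w / 2)"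
      unfolding 1 2 using t w by (simp add: real_sqrt_mult real_sqrt_divide)
    moreover have "\<bar>(1 + a * b / t\<^sup>2) / 2\<bar> = w / (2 * t)"
      using t p by (simp add: w_def power2_eq_square field_simps add_pos_pos)
    ultimately show "\<bar>(1 + a * b / t\<^sup>2) / 2\<bar> * agm_fun ((a + b) / 2) c (?g t) = 2 * agm_fun a b t"
      using t w by (simp add: agm_fun_def)
  qed
  \<comment> \<open>The substitution maps the half-line onto the whole line; evenness turns the
    remaining factor 2 back into an integral over the line.\<close>
  also have "\<dots> \<longleftrightarrow> (agm_fun a b has_integral I) UNIV"
  proof
    assume "((\<lambda>t. 2 * agm_fun a b t) has_integral I) {0<..}"
    from has_integral_divide[OF this, of 2] have "(agm_fun a b has_integral I / 2) {0<..}" by simp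
    from even_has_integral_UNIV[OF this] show "(agm_fun a b has_integral I) UNIV" by simp
  next
    assume "(agm_fun a b has_integral I) UNIV"
    from has_integral_mult_right[OF even_has_integral_half[OF this], of 2]
    show "((\<lambda>t. 2 * agm_fun a b t) has_integral I) {0<..}" by simp
  qed
  finally show ?thesis ..
qed

section \<open>Bounds and special values of the elliptic integral\<close>

lemma tan_image_UNIV: "tan ` {-(pi/2)<..<pi/2} = (UNIV :: real set)"
proof -
  have "y \<in> tan ` {-(pi/2)<..<pi/2}" for y
    using arctan[of y] by (intro image_eqI[of _ _ "arctan y"]) auto
  then show ?thesis by auto
qed

lemma agm_integral_diagonal:
  assumes m: "m > 0"
  shows "(agm_fun m m has_integral pi / m) UNIV"
proof -
  let ?S = "{-(pi/2)<..<pi/2}"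
  let ?g = "\<lambda>x. m * tan x"
  have cos: "cos x > 0" if "x \<in> ?S" for x using that by (intro cos_gt_zero_pi) auto
  have "?g ` ?S = (*) m ` UNIV" unfolding tan_image_UNIV[symmetric] by auto
  also have "\<dots> = UNIV" using m by (simp add: surj_def)
  finally have im: "?g ` ?S = UNIV" .
  have "(agm_fun m m has_integral pi / m) UNIV \<longleftrightarrow>
     ((\<lambda>x. \<bar>m * inverse ((cos x)\<^sup>2)\<bar> * agm_fun m m (?g x)) has_integral pi / m) ?S"
    unfolding im[symmetric]
  proof (rule has_integral_substitution_nonneg)
    show "(?g has_field_derivative m * inverse ((cos x)\<^sup>2)) (at x within ?S)" if "x \<in> ?S" for x
      using cos[OF that] by (intro DERIV_cmult has_field_derivative_at_within[OF DERIV_tan]) auto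
    show "inj_on ?g ?S"
    proof (rule inj_onI)
      fix x y assume xy: "x \<in> ?S" "y \<in> ?S" "?g x = ?g y"
      then have "arctan (tan x) = arctan (tan y)" using m by simp
      with xy show "x = y" by (simp add: arctan_tan)
    qed
  qed auto
  also have "\<dots> \<longleftrightarrow> ((\<lambda>x. 1 / m) has_integral pi / m) ?S"
  proof (rule has_integral_cong)
    fix x assume "x \<in> ?S"
    then have c: "cos x > 0" by (rule cos)
    have "(?g x)\<^sup>2 + m\<^sup>2 = m\<^sup>2 * inverse ((cos x)\<^sup>2)"
      using c sin_cos_squared_add[of x] by (simp add: tan_def power_divide field_simps flip: distrib_left)
    then have "agm_fun m m (?g x) = 1 / (m\<^sup>2 * inverse ((cos x)\<^sup>2))"
      using m by (simp add: agm_fun_def)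
    then show "\<bar>m * inverse ((cos x)\<^sup>2)\<bar> * agm_fun m m (?g x) = 1 / m"
      using m c by (simp add: power2_eq_square)
  qed
  also have "\<dots>"
    using has_integral_const_real[of "1 / m" "-(pi/2)" "pi/2"] by (simp add: has_integral_Icc_iff_Ioo)
  finally show ?thesis .
qed

lemma agm_fun_antimono:
  assumes "0 < a" "a \<le> a'" "0 < b" "b \<le> b'"
  shows "agm_fun a' b' x \<le> agm_fun a b x"
proof -
  have "a\<^sup>2 \<le> a'\<^sup>2" "b\<^sup>2 \<le> b'\<^sup>2" using assms by (auto intro: power_mono)
  then have "(x\<^sup>2 + a\<^sup>2) * (x\<^sup>2 + b\<^sup>2) \<le> (x\<^sup>2 + a'\<^sup>2) * (x\<^sup>2 + b'\<^sup>2)"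
    by (intro mult_mono) auto
  moreover have "(x\<^sup>2 + a\<^sup>2) * (x\<^sup>2 + b\<^sup>2) > 0"
    using assms by (intro mult_pos_pos add_nonneg_pos) auto
  ultimately show ?thesis
    unfolding agm_fun_def by (intro divide_left_mono) auto
qed

text \<open>Comparison with equal parameters, where the integral is elementary. These bounds let the
  parameters tend to a limit without interchanging limit and integral.\<close>

lemma agm_integral_bounds:
  assumes "(agm_fun a b has_integral I) UNIV" "0 < a" "0 < b"
  shows "pi / max a b \<le> I" "I \<le> pi / min a b"
proof -
  show "pi / max a b \<le> I"
    by (rule has_integral_le[OF agm_integral_diagonal assms(1)]) (use assms in \<open>auto intro!: agm_fun_antimono\<close>)
  show "I \<le> pi / min a b"
    by (rule has_integral_le[OF assms(1) agm_integral_diagonal]) (use assms in \<open>auto intro!: agm_fun_antimono\<close>)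
qed

lemma agm_integral_scale:
  assumes "c > 0" "(agm_fun (c * a) (c * b) has_integral I) UNIV"
  shows "(agm_fun a b has_integral c * I) UNIV"
proof -
  have im: "(*) c ` UNIV = UNIV"
    using assms(1) by (simp add: surj_def dvd_def[symmetric] dvd_field_iff)
  have "(agm_fun (c * a) (c * b) has_integral I) UNIV \<longleftrightarrow>
     ((\<lambda>x. \<bar>c\<bar> * agm_fun (c * a) (c * b) (c * x)) has_integral I) UNIV"
    by (subst (1) im[symmetric], rule has_integral_substitution_nonneg)
      (use assms(1) in \<open>auto intro!: derivative_eq_intros simp: inj_on_def\<close>)
  moreover have "\<bar>c\<bar> * agm_fun (c * a) (c * b) (c * x) = agm_fun a b x / c" for x
  proof -
    have "((c * x)\<^sup>2 + (c * a)\<^sup>2) * ((c * x)\<^sup>2 + (c * b)\<^sup>2) = (c\<^sup>2)\<^sup>2 * ((x\<^sup>2 + a\<^sup>2) * (x\<^sup>2 + b\<^sup>2))"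
      by (simp add: power2_eq_square algebra_simps)
    then have "agm_fun (c * a) (c * b) (c * x) = agm_fun a b x / c\<^sup>2"
      by (simp only: agm_fun_def real_sqrt_mult real_sqrt_abs) (simp add: mult.commute)
    then show ?thesis using assms(1) by (simp add: power2_eq_square)
  qed
  ultimately have "((\<lambda>x. agm_fun a b x / c) has_integral I) UNIV" using assms(2) by simp
  from has_integral_mult_right[OF this, of c] show ?thesis using assms(1) by simp
qed

text \<open>The substitution w = 1 / (x^2 + 1)^2 turns the half-line integral into the Beta integral
  with exponents 1/4 and 1/2. In terms of \<open>v\<close>, the two factors under the root are v + 1
  and v.\<close>

lemma agm_integral_lemniscatic:
  "(agm_fun (sqrt 2) 1 has_integral Beta (1 / 4) (1 / 2) / 2) UNIV"
proof -
  let ?S = "{0<..<1::real}"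
  define v where "v = (\<lambda>w::real. w powr (- 1 / 2))"
  have v1: "v w > 1" if "w \<in> ?S" for w
    using that powr_less_mono2_neg[of "- 1 / 2" w 1] by (simp add: v_def)
  have w: "w = 1 / (v w)\<^sup>2" if "w \<in> ?S" for w
    using that by (simp add: v_def powr_minus_divide powr_half_sqrt power_divide)
  let ?g = "\<lambda>w. sqrt (v w - 1)"
  have im: "?g ` ?S = {0<..}"
  proof safe
    fix y :: real assume y: "y > 0"
    have "1 / (y\<^sup>2 + 1)\<^sup>2 \<in> ?S"
      using y by (simp add: power2_eq_square divide_less_eq add_pos_pos algebra_simps)
    moreover have "v (1 / (y\<^sup>2 + 1)\<^sup>2) = y\<^sup>2 + 1"
    proof -
      have "1 / (y\<^sup>2 + 1)\<^sup>2 = (y\<^sup>2 + 1) powr (- 2)"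
        by (simp add: powr_minus_divide add_nonneg_pos powr_numeral)
      moreover have "y\<^sup>2 + 1 > 0" by (simp add: add_nonneg_pos)
      ultimately show ?thesis by (simp only: v_def powr_powr) simp
    qed
    ultimately show "y \<in> ?g ` ?S" using y by (intro image_eqI[of _ _ "1 / (y\<^sup>2 + 1)\<^sup>2"]) simp_all
  qed (use v1 in force)
  have "(agm_fun (sqrt 2) 1 has_integral Beta (1 / 4) (1 / 2) / 4) {0<..} \<longleftrightarrow>
    ((\<lambda>x. \<bar>- (v x ^ 3) / (4 * sqrt (v x - 1))\<bar> * agm_fun (sqrt 2) 1 (?g x)) has_integral Beta (1 / 4) (1 / 2) / 4) ?S"
    unfolding im[symmetric]
  proof (rule has_integral_substitution_nonneg)
    fix x assume x: "x \<in> ?S"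
    have "(v has_field_derivative (- 1 / 2 * x powr (- 1 / 2 - 1))) (at x)"
      unfolding v_def using x by (intro has_real_derivative_powr) auto
    also have "x powr (- 1 / 2 - 1) = v x ^ 3"
      using x by (simp add: v_def powr_power)
    finally have "(v has_field_derivative (- 1 / 2 * (v x ^ 3))) (at x within ?S)"
      by (rule has_field_derivative_at_within)
    then show "(?g has_field_derivative - (v x ^ 3) / (4 * sqrt (v x - 1))) (at x within ?S)"
      using v1[OF x] by (auto intro!: derivative_eq_intros simp: field_simps)
  next
    show "inj_on ?g ?S"
    proof (rule inj_onI)
      fix x y assume "x \<in> ?S" "y \<in> ?S" "?g x = ?g y"
      then show "x = y" using w[of x] w[of y] by simp
    qed
  qed auto
  also have "\<dots> \<longleftrightarrow> ((\<lambda>x. x powr (1 / 4 - 1) * (1 - x) powr (1 / 2 - 1) / 4) has_integral Beta (1 / 4) (1 / 2) / 4) ?S"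
  proof (rule has_integral_cong)
    fix x assume x: "x \<in> ?S"
    define u where "u = v x"
    have u: "u > 1" using v1[OF x] by (simp add: u_def)
    have "x powr (1 / 4 - 1) = u powr (3 / 2)"
      using x by (simp add: u_def v_def powr_powr)
    also have "\<dots> = u * sqrt u"
      using u powr_add[of u 1 "1 / 2"] by (simp add: powr_half_sqrt)
    finally have 1: "x powr (1 / 4 - 1) = u * sqrt u" .
    have "1 - x = (u - 1) * (u + 1) / u\<^sup>2"
      using w[OF x] u unfolding u_def[symmetric] by (simp add: power2_eq_square field_simps)
    then have "sqrt (1 - x) = sqrt (u - 1) * sqrt (u + 1) / u"
      using u by (simp add: real_sqrt_mult real_sqrt_divide)
    then have 2: "(1 - x) powr (1 / 2 - 1) = u / (sqrt (u - 1) * sqrt (u + 1))"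
      using x by (simp add: powr_minus_divide powr_half_sqrt)
    have "(sqrt (u - 1))\<^sup>2 = u - 1" using u by simp
    then have 3: "agm_fun (sqrt 2) 1 (sqrt (u - 1)) = 1 / (sqrt (u + 1) * sqrt u)"
      unfolding agm_fun_def by (simp add: real_sqrt_mult add.commute)
    have "u * u * u = u * u * (sqrt u * sqrt u)" using u by simp
    then have "u ^ 3 / sqrt u = u * u * sqrt u" using u by (simp add: power3_eq_cube field_simps)
    then show "\<bar>- (v x ^ 3) / (4 * sqrt (v x - 1))\<bar> * agm_fun (sqrt 2) 1 (?g x) =
      x powr (1 / 4 - 1) * (1 - x) powr (1 / 2 - 1) / 4"
      unfolding u_def[symmetric] 1 2 3 using u by (simp add: abs_mult field_simps)
  qed
  also have "\<dots>"
    using has_integral_divide[OF has_integral_Beta_real[of "1 / 4" "1 / 2"], of 4]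
    by (simp add: has_integral_Icc_iff_Ioo)
  finally have "(agm_fun (sqrt 2) 1 has_integral Beta (1 / 4) (1 / 2) / 4) {0<..}" .
  from even_has_integral_UNIV[OF this] show ?thesis by simp
qed

text \<open>Euler's reflection formula at 1/4 eliminates Gamma (1 / 4).\<close>

lemma Beta_quarter_half: "Beta (1 / 4) (1 / 2) = sqrt 2 * pi * sqrt pi / (Gamma (3 / 4 :: real))\<^sup>2"
proof -
  have "complex_of_real (Gamma (1 / 4) * Gamma (3 / 4)) = Gamma (1 / 4) * Gamma (1 - 1 / 4)"
    by (simp add: Gamma_complex_of_real[symmetric])
  also have "\<dots> = complex_of_real (pi / sin (pi / 4))"
    by (subst Gamma_reflection_complex) (simp add: sin_of_real[symmetric])
  finally have "Gamma (1 / 4) * Gamma (3 / 4) = pi / sin (pi / 4)"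
    by (simp only: of_real_eq_iff)
  also have "\<dots> = sqrt 2 * pi" by (simp add: sin_45 field_simps)
  finally have 1: "Gamma (1 / 4) * Gamma (3 / 4) = sqrt 2 * pi" .
  have "Gamma (3 / 4 :: real) > 0" by (rule Gamma_real_pos) simp
  then have "Gamma (3 / 4 :: real) \<noteq> 0" by (metis less_irrefl)
  then have "Gamma (1 / 4 :: real) = sqrt 2 * pi / Gamma (3 / 4)"
    using 1 by (rule eq_divide_imp)
  then show ?thesis
    unfolding Beta_def by (simp add: Gamma_one_half_real power2_eq_square)
qed

text \<open>For t \<ge> 1 and k nonzero, t k^2 \<ge> (t - 1) + k^2. All terms except k = 0 are thus
  bounded by exp (- (pi * (t - 1))) times the series at t = 1.\<close>

lemma theta_constants_tendsto_1:
  "(\<lambda>n. \<theta>3 (2 ^ n)) \<longlonglongrightarrow> 1" "(\<lambda>n. \<theta>4 (2 ^ n)) \<longlonglongrightarrow> 1"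
proof -
  define B where "B = (\<lambda>t. exp (- (pi * (t - 1))) * \<theta>3 1)"
  have le: "exp (- (pi * t * (of_int k)\<^sup>2)) \<le> exp (- (pi * (t - 1))) * exp (- (pi * 1 * (of_int k)\<^sup>2))"
    if "t \<ge> 1" "k \<noteq> 0" for t and k :: int
  proof -
    have "0 < k\<^sup>2" using that(2) by simp
    then have "1 \<le> k\<^sup>2" by linarith
    then have "1 \<le> (of_int k :: real)\<^sup>2" by (metis of_int_1_le_iff of_int_power)
    then have "(t - 1) * 1 \<le> (t - 1) * (of_int k)\<^sup>2" using that(1) by (intro mult_left_mono) auto
    then have "pi * (t - 1) + pi * 1 * (of_int k)\<^sup>2 \<le> pi * t * (of_int k)\<^sup>2"
      using mult_left_mono[of "t - 1 + (of_int k)\<^sup>2" "t * (of_int k)\<^sup>2" pi] by (simp add: algebra_simps)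
    then show ?thesis unfolding exp_add[symmetric] by simp
  qed
  have one: "((\<lambda>k::int. - (if k = 0 then 1 else 0 :: real)) has_sum - 1) UNIV"
    by (rule has_sum_finite_neutralI[where B = "{0}"]) auto
  have Bsum: "((\<lambda>k::int. exp (- (pi * (t - 1))) * exp (- (pi * 1 * (of_int k)\<^sup>2))) has_sum B t) UNIV" for t
    unfolding B_def by (intro has_sum_cmult_right \<theta>3_has_sum) auto
  have 3: "norm (\<theta>3 t + - 1) \<le> B t" if "t \<ge> 1" for t
  proof (rule norm_infsum_le[OF has_sum_add[OF \<theta>3_has_sum one] Bsum])
    fix k :: int
    show "norm (exp (- (pi * t * (of_int k)\<^sup>2)) + - (if k = 0 then 1 else 0)) \<le> exp (- (pi * (t - 1))) * exp (- (pi * 1 * (of_int k)\<^sup>2))"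
      using le[OF that, of k] by simp
  qed (use that in auto)
  have 4: "norm (\<theta>4 t + - 1) \<le> B t" if "t \<ge> 1" for t
  proof (rule norm_infsum_le[OF has_sum_add[OF \<theta>4_has_sum one] Bsum])
    fix k :: int
    show "norm (exp (- (pi * t * (of_int k)\<^sup>2)) * parity_sign k + - (if k = 0 then 1 else 0)) \<le> exp (- (pi * (t - 1))) * exp (- (pi * 1 * (of_int k)\<^sup>2))"
      using le[OF that, of k] by (simp add: abs_mult parity_sign_def)
  qed (use that in auto)
  have "(\<lambda>n. exp (- (pi * (2 ^ n - 1))) * \<theta>3 1) \<longlonglongrightarrow> 0 * \<theta>3 1"
    by (intro tendsto_intros) real_asymp
  then have lim: "(\<lambda>n. B (2 ^ n)) \<longlonglongrightarrow> 0" by (simp add: B_def)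
  show "(\<lambda>n. \<theta>3 (2 ^ n)) \<longlonglongrightarrow> 1"
    by (rule LIM_zero_cancel, rule tendsto_norm_zero_cancel, rule tendsto_sandwich[OF _ _ tendsto_const lim])
      (use 3 in \<open>auto intro!: always_eventually\<close>)
  show "(\<lambda>n. \<theta>4 (2 ^ n)) \<longlonglongrightarrow> 1"
    by (rule LIM_zero_cancel, rule tendsto_norm_zero_cancel, rule tendsto_sandwich[OF _ _ tendsto_const lim])
      (use 4 in \<open>auto intro!: always_eventually\<close>)
qed

text \<open>Positivity is hidden in the alternating series, but Poisson summation turns it into a
  series with positive terms.\<close>

lemma \<theta>4_pos:
  assumes "t > 0"
  shows "\<theta>4 t > 0"
  using Poisson_theta[of "1 / t" "1 / 2"] theta_pos[of "1 / t" "1 / 2"] assms by simp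

text \<open>Doubling t performs one arithmetic-geometric step on the squares, so the integral is the
  same for every 2^n. Both squares tend to 1, and the comparison bounds squeeze the constant value
  to pi.\<close>

lemma agm_integral_theta:
  assumes I: "(agm_fun ((\<theta>3 1)\<^sup>2) ((\<theta>4 1)\<^sup>2) has_integral I) UNIV"
  shows "I = pi"
proof -
  let ?a = "\<lambda>n. (\<theta>3 (2 ^ n))\<^sup>2" and ?b = "\<lambda>n. (\<theta>4 (2 ^ n))\<^sup>2"
  have pos: "?a n > 0" "?b n > 0" for n :: nat
    using theta_pos[of "2 ^ n" 0] \<theta>4_pos[of "2 ^ n"] by simp_all
  have In: "(agm_fun (?a n) (?b n) has_integral I) UNIV" for n
  proof (induction n)
    case (Suc n)
    have t: "(2::real) ^ n > 0" by simp
    have a: "?a (Suc n) = (?a n + ?b n) / 2"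
      using \<theta>3_square[OF t] \<theta>4_square[OF t] by simp
    have b: "(?b (Suc n))\<^sup>2 = ?a n * ?b n"
      using \<theta>3_mult_\<theta>4[OF t] by (simp add: power_mult_distrib[symmetric])
    show ?case
      unfolding a using agm_integral_step[OF pos _ b] Suc by simp
  qed (use I in simp)
  have a: "?a \<longlonglongrightarrow> 1\<^sup>2" and b: "?b \<longlonglongrightarrow> 1\<^sup>2"
    by (intro tendsto_power theta_constants_tendsto_1)+
  have "(\<lambda>n. pi / max (?a n) (?b n)) \<longlonglongrightarrow> pi"
    using tendsto_divide[OF tendsto_const tendsto_max[OF a b], of pi] by simp
  then have "pi \<le> I"
    by (rule LIMSEQ_le_const2) (use agm_integral_bounds(1)[OF In pos] in auto)
  moreover have "(\<lambda>n. pi / min (?a n) (?b n)) \<longlonglongrightarrow> pi"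
    using tendsto_divide[OF tendsto_const tendsto_min[OF a b], of pi] by simp
  then have "I \<le> pi"
    by (rule LIMSEQ_le_const) (use agm_integral_bounds(2)[OF In pos] in auto)
  ultimately show ?thesis by simp
qed

text \<open>At the fixed point of inversion the squares of \<open>\<theta>3\<close> and
  \<open>\<theta>4\<close> are in the ratio sqrt 2 to 1, which is the lemniscatic case. Homogeneity
  of the integral then determines their size.\<close>

theorem \<theta>3_1: "\<theta>3 1 = pi powr (1 / 4) / Gamma (3 / 4)"
proof -
  have "\<theta>2 1 = \<theta>4 1" using Poisson_theta[of 1 "1 / 2"] by simp
  then have "\<theta>3 1 ^ 4 = 2 * \<theta>4 1 ^ 4" using Jacobi_quartic[of 1] by simp
  then have "((\<theta>3 1)\<^sup>2)\<^sup>2 = (sqrt 2 * (\<theta>4 1)\<^sup>2)\<^sup>2" by (simp add: power_mult_distrib)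
  then have eq: "(\<theta>3 1)\<^sup>2 = sqrt 2 * (\<theta>4 1)\<^sup>2" by (rule power2_eq_imp_eq) auto
  define b where "b = (\<theta>4 1)\<^sup>2"
  have b: "b > 0" using \<theta>4_pos[of 1] by (simp add: b_def)
  have "(agm_fun ((1 / b) * (b * sqrt 2)) ((1 / b) * b) has_integral Beta (1 / 4) (1 / 2) / 2) UNIV"
    using agm_integral_lemniscatic b by simp
  from agm_integral_scale[OF _ this] b
  have "(agm_fun (b * sqrt 2) b has_integral Beta (1 / 4) (1 / 2) / 2 / b) UNIV" by (simp add: mult.commute)
  then have "Beta (1 / 4) (1 / 2) / 2 / b = pi"
    using agm_integral_theta eq by (simp add: b_def mult.commute)
  then have "b = Beta (1 / 4) (1 / 2) / (2 * pi)" using b by (simp add: field_simps)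
  then have "(\<theta>3 1)\<^sup>2 = sqrt pi / (Gamma (3 / 4))\<^sup>2"
    using eq unfolding Beta_quarter_half b_def[symmetric] by (simp add: field_simps)
  also have "\<dots> = (pi powr (1 / 4) / Gamma (3 / 4))\<^sup>2"
    by (simp add: power_divide powr_power powr_half_sqrt)
  finally show ?thesis
    using theta_pos[of 1 0] by (subst (asm) power2_eq_iff_nonneg) (auto intro!: divide_nonneg_pos Gamma_real_pos less_imp_le)
qed

section \<open>Evaluation at level three\<close>

text \<open>The square of a half-integer exceeds the square of its neighbouring integer nearer to 0
  by at least 1/4. The estimate serves to select a root below.\<close>

lemma \<theta>2_le:
  assumes t: "t > 0"
  shows "\<theta>2 t \<le> 2 * exp (- (pi * t / 4)) * \<theta>3 t"
proof -
  have "\<theta>2 t \<le> exp (- (pi * t / 4)) * (theta t 0 + theta t 1)"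
  proof (rule has_sum_mono[OF theta_has_sum[OF t] has_sum_cmult_right[OF has_sum_add[OF theta_has_sum[OF t] theta_has_sum[OF t]]]])
    fix k :: int
    let ?e = "\<lambda>c::real. exp (- (pi * t * (of_int k + c)\<^sup>2))"
    have "\<exists>c\<in>{0, 1}. 1 / 4 + (of_int k + c)\<^sup>2 \<le> (of_int k + 1 / 2 :: real)\<^sup>2"
    proof (cases "k \<ge> 0")
      case False
      then have "of_int k \<le> (- 1 :: real)" by linarith
      then show ?thesis by (simp add: power2_eq_square algebra_simps)
    qed (simp add: power2_eq_square algebra_simps)
    then obtain c :: real where c: "c \<in> {0, 1}" "1 / 4 + (of_int k + c)\<^sup>2 \<le> (of_int k + 1 / 2)\<^sup>2" by blast
    from mult_left_mono[OF c(2), of "pi * t"] t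
    have "?e (1 / 2) \<le> exp (- (pi * t / 4)) * ?e c"
      by (simp add: exp_add[symmetric] algebra_simps)
    also have "\<dots> \<le> exp (- (pi * t / 4)) * (?e 0 + ?e 1)"
      using c(1) by (intro mult_left_mono) auto
    finally show "?e (1 / 2) \<le> exp (- (pi * t / 4)) * (?e 0 + ?e 1)" .
  qed
  also have "theta t 1 = theta t 0" using theta_add_int[of t 0 1] by simp
  finally show ?thesis by simp
qed

lemma ctheta_neg: "ctheta t (- b) = ctheta t b"
  by (simp add: ctheta_def)

lemma ctheta_add_1: "ctheta t (b + 1) = ctheta t b"
  unfolding ctheta_def using cos_int_2pin sin_int_2pin
  by (intro infsum_cong) (simp add: distrib_left cos_add)

text \<open>Trisection at t = 1/3 with b = 0 lands at 9 * t = 3, and Poisson summation carries the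
  three terms at 1/3 to 3 as well, leaving a linear relation at t = 3 alone.\<close>

lemma theta_3_third: "2 * theta 3 (1 / 3) = (sqrt 3 - 1) * \<theta>3 3"
proof -
  have P: "ctheta (1 / 3) b = sqrt 3 * theta 3 b" if "b \<in> {0..1}" for b
    using Poisson_theta[of 3 b] that by simp
  have s3: "sqrt 3 * (sqrt 3 * x) = 3 * x" for x :: real by (simp add: mult.assoc[symmetric])
  have "sqrt 3 * (\<theta>3 3 + 2 * theta 3 (1 / 3)) = sqrt 3 * (sqrt 3 * \<theta>3 3)"
    using ctheta_trisection[of "1 / 3" 0] P[of 0] P[of "1 / 3"] ctheta_neg[of "1 / 3" "1 / 3"] ctheta_0[of 3]
    unfolding s3 by (simp add: distrib_left)
  then have "\<theta>3 3 + 2 * theta 3 (1 / 3) = sqrt 3 * \<theta>3 3" by simp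
  then show ?thesis by (simp add: algebra_simps)
qed

lemma theta_3_sixth: "2 * theta 3 (1 / 6) = sqrt 3 * \<theta>4 3 - \<theta>2 3"
proof -
  have P: "ctheta (1 / 3) b = sqrt 3 * theta 3 b" if "b \<in> {0..1}" for b
    using Poisson_theta[of 3 b] that by simp
  have s3: "sqrt 3 * (sqrt 3 * x) = 3 * x" for x :: real by (simp add: mult.assoc[symmetric])
  have "theta 3 (5 / 6) = theta 3 (1 / 6)"
    using theta_add_int[of 3 "- 1 / 6" 1] theta_neg[of 3 "1 / 6"] by simp
  moreover have "ctheta 3 (3 / 2) = \<theta>4 3"
    using ctheta_add_1[of 3 "1 / 2"] by simp
  ultimately have "sqrt 3 * (\<theta>2 3 + 2 * theta 3 (1 / 6)) = sqrt 3 * (sqrt 3 * \<theta>4 3)"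
    using ctheta_trisection[of "1 / 3" "1 / 2"] P[of "1 / 2"] P[of "5 / 6"] P[of "1 / 6"]
    unfolding s3 by (simp add: distrib_left)
  then have "\<theta>2 3 + 2 * theta 3 (1 / 6) = sqrt 3 * \<theta>4 3" by simp
  then show ?thesis by simp
qed

lemma \<theta>3_3: "\<theta>3 1 ^ 4 = (6 * sqrt 3 - 9) * \<theta>3 3 ^ 4"
proof -
  have S: "theta 3 (1 / 3) = (sqrt 3 - 1) / 2 * \<theta>3 3" using theta_3_third by simp
  have "(sqrt 3 - 1) ^ 3 = 6 * sqrt 3 - 10"
    by (simp add: power3_eq_cube algebra_simps)
  moreover have "8 * (w / 2) ^ 3 = w ^ 3" for w :: real by (simp add: power_divide)
  ultimately have c: "1 + 8 * ((sqrt 3 - 1) / 2) ^ 3 = 6 * sqrt 3 - 9" by (simp only:)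
  have "\<theta>3 1 ^ 4 = \<theta>3 3 ^ 4 + 8 * \<theta>3 3 * theta 3 (1 / 3) ^ 3"
    using theta_tetracode[of 1] by simp
  then have "\<theta>3 1 ^ 4 = (1 + 8 * c ^ 3) * \<theta>3 3 ^ 4" if "theta 3 (1 / 3) = c * \<theta>3 3" for c
    unfolding that by (simp add: power_mult_distrib algebra_simps power4_eq_xxxx power3_eq_cube)
  from this[OF S] show ?thesis unfolding c .
qed

lemma \<theta>3_1_eq: "\<theta>3 1 = sqrt (sqrt 2) * \<theta>4 1" "\<theta>2 1 = \<theta>4 1"
proof -
  show 2: "\<theta>2 1 = \<theta>4 1" using Poisson_theta[of 1 "1 / 2"] by simp
  have "(sqrt (sqrt 2)) ^ 4 = ((sqrt (sqrt 2))\<^sup>2)\<^sup>2" by (simp del: real_sqrt_pow2)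
  then have "\<theta>3 1 ^ 4 = (sqrt (sqrt 2) * \<theta>4 1) ^ 4"
    using Jacobi_quartic[of 1] 2 by (simp add: power_mult_distrib)
  then show "\<theta>3 1 = sqrt (sqrt 2) * \<theta>4 1"
    by (rule power_eq_imp_eq_base) (use theta_pos[of 1] \<theta>4_pos[of 1] in \<open>auto intro: less_imp_le\<close>)
qed

text \<open>In terms of the product p = u v the quartic condition reads 2 (k^2 - p)^2 = 3; the bound
  p \<le> k^2 selects its root, and 2 u \<le> k the sign of v - u. The factor sqrt 3 + 1 makes the
  square of the left side simple, and it is the coefficient with which v - u occurs later.\<close>

lemma quartic_sum_solution:
  fixes u v k :: real
  assumes uv: "u + v = k" "u ^ 4 + v ^ 4 = 1" and k: "k > 0" "k\<^sup>2 = sqrt 2" and u: "0 \<le> u" "2 * u \<le> k"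
  shows "(sqrt 3 + 1) * (v - u) = k * sqrt (2 * sqrt 3)"
proof -
  define p where "p = u * v"
  have "(k\<^sup>2 - 2 * p)\<^sup>2 - 2 * p\<^sup>2 = u ^ 4 + v ^ 4"
    unfolding p_def uv(1)[symmetric] by (simp add: power2_eq_square power4_eq_xxxx algebra_simps)
  moreover have k4: "(k\<^sup>2)\<^sup>2 = 2" unfolding k(2) by simp
  moreover have "(k\<^sup>2 - 2 * p)\<^sup>2 - 2 * p\<^sup>2 = 2 * (k\<^sup>2 - p)\<^sup>2 - (k\<^sup>2)\<^sup>2"
    by algebra
  ultimately have "2 * (k\<^sup>2 - p)\<^sup>2 = 3"
    using uv(2) by linarith
  moreover have "(sqrt 6 / 2)\<^sup>2 = (3 / 2 :: real)" by (simp add: power_divide)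
  ultimately have "(k\<^sup>2 - p)\<^sup>2 = (sqrt 6 / 2)\<^sup>2" by linarith
  moreover have "k\<^sup>2 - p \<ge> 0"
  proof -
    have "u \<le> k" "v \<le> k" "0 \<le> k" "0 \<le> v" using uv(1) u k(1) by linarith+
    then have "u * v \<le> k * k" by (intro mult_mono)
    then show ?thesis by (simp add: p_def power2_eq_square)
  qed
  ultimately have "k\<^sup>2 - p = sqrt 6 / 2" by (rule power2_eq_imp_eq) simp
  then have p: "p = sqrt 2 - sqrt 6 / 2" using k(2) by simp
  have "(v - u)\<^sup>2 = k\<^sup>2 - 4 * p" unfolding p_def uv(1)[symmetric] by (simp add: power2_eq_square algebra_simps)
  also have "\<dots> = 2 * (sqrt 2 * sqrt 3) - 3 * sqrt 2"
    unfolding p k(2) by (simp add: real_sqrt_mult[symmetric])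
  finally have d: "(v - u)\<^sup>2 = sqrt 2 * (2 * sqrt 3 - 3)" by (simp add: algebra_simps)
  have "((sqrt 3 + 1) * (v - u))\<^sup>2 = sqrt 2 * ((sqrt 3 + 1)\<^sup>2 * (2 * sqrt 3 - 3))"
    unfolding power_mult_distrib d by simp
  also have "(sqrt 3 + 1)\<^sup>2 * (2 * sqrt 3 - 3) = 2 * sqrt 3"
    by (simp add: power2_eq_square algebra_simps)
  also have "sqrt 2 * (2 * sqrt 3) = (k * sqrt (2 * sqrt 3))\<^sup>2"
    unfolding power_mult_distrib k(2) by simp
  finally show ?thesis
  proof (rule power2_eq_imp_eq)
    have "0 \<le> v - u" using uv(1) u by linarith
    then show "0 \<le> (sqrt 3 + 1) * (v - u)" by simp
    show "0 \<le> k * sqrt (2 * sqrt 3)" using k(1) by simp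
  qed
qed

lemma theta_3_sixth_eq:
  "theta 3 (1 / 6) = \<theta>3 3 * sqrt (sqrt 2) * (sqrt 3 - 1 + sqrt (2 * sqrt 3)) / 4"
proof -
  define u v k where "u = \<theta>2 3 / \<theta>3 3" and "v = \<theta>4 3 / \<theta>3 3" and "k = sqrt (sqrt 2)"
  have pos: "\<theta>3 3 > 0" "\<theta>4 1 > 0" by (simp_all add: theta_pos \<theta>4_pos)
  have k: "k > 0" "k\<^sup>2 = sqrt 2" by (simp_all add: k_def)
  have "\<theta>4 1 * (k * \<theta>3 3) = \<theta>4 1 * (\<theta>4 3 + \<theta>2 3)"
    using theta_degree_3[of 1] unfolding \<theta>3_1_eq k_def by (simp add: algebra_simps)
  then have "k * \<theta>3 3 = \<theta>4 3 + \<theta>2 3" using pos by (metis mult_left_cancel less_irrefl)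
  then have uv: "u + v = k" using pos by (simp add: u_def v_def field_simps)
  have "u ^ 4 + v ^ 4 = 1"
  proof -
    have "u ^ 4 + v ^ 4 = (\<theta>2 3 ^ 4 + \<theta>4 3 ^ 4) / \<theta>3 3 ^ 4"
      by (simp add: u_def v_def power_divide add_divide_distrib)
    also have "\<dots> = 1"
      by (subst Jacobi_quartic[symmetric]) (use pos in auto)
    finally show ?thesis .
  qed
  moreover have "u \<ge> 0" using theta_pos[of 3 "1 / 2"] pos by (simp add: u_def)
  moreover have "2 * u \<le> k"
  proof -
    \<comment> \<open>A crude numerical estimate: with pi > 3 it gives exp (pi * 3 / 4) \<ge> 4,
      hence \<open>\<theta>2 3\<close> is at most half of \<open>\<theta>3 3\<close>, while
      \<open>k\<close> is at least 1.\<close>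
    have "17 / 8 \<le> exp (9 / 8 :: real)" using exp_ge_add_one_self[of "9 / 8 :: real"] by simp
    then have "(17 / 8)\<^sup>2 \<le> (exp (9 / 8 :: real))\<^sup>2" by (intro power_mono) auto
    also have "\<dots> = exp (9 / 4)" by (simp add: exp_double[symmetric])
    also have "\<dots> \<le> exp (pi * 3 / 4)" using pi_gt3 by simp
    finally have "4 \<le> exp (pi * 3 / 4)" by (simp add: power2_eq_square)
    then have "exp (- (pi * 3 / 4)) \<le> 1 / 4" by (simp add: exp_minus field_simps)
    then have "2 * exp (- (pi * 3 / 4)) * \<theta>3 3 \<le> 1 / 2 * \<theta>3 3" using pos by (intro mult_right_mono) auto
    then have "\<theta>2 3 \<le> 1 / 2 * \<theta>3 3" using \<theta>2_le[of 3] by linarith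
    then have "2 * u \<le> 1" using pos by (simp add: u_def field_simps)
    also have "1 \<le> k" by (simp add: k_def)
    finally show ?thesis .
  qed
  ultimately have d: "(sqrt 3 + 1) * (v - u) = k * sqrt (2 * sqrt 3)"
    using quartic_sum_solution uv k by blast
  have "4 * theta 3 (1 / 6) = \<theta>3 3 * (2 * (sqrt 3 * v - u))"
  proof -
    have "sqrt 3 * v - u = (sqrt 3 * \<theta>4 3 - \<theta>2 3) / \<theta>3 3"
      by (simp add: u_def v_def diff_divide_distrib)
    then show ?thesis unfolding theta_3_sixth[symmetric] using pos by simp
  qed
  \<comment> \<open>Rewritten through the sum and the difference of \<open>u\<close> and
    \<open>v\<close>, the two quantities that are known.\<close>
  also have "2 * (sqrt 3 * v - u) = (sqrt 3 - 1) * (u + v) + (sqrt 3 + 1) * (v - u)"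
    by (simp add: algebra_simps)
  also have "\<dots> = k * (sqrt 3 - 1 + sqrt (2 * sqrt 3))"
    unfolding d uv by (simp add: algebra_simps)
  finally show ?thesis by (simp add: k_def)
qed

text \<open>Since \<open>\<theta>3 3\<close> is related to \<open>\<theta>3 1\<close> through fourth
  powers, the fourth powers of both sides are compared; positivity then allows the root to be
  taken.\<close>

lemma theta_3_sixth_eq_\<theta>3_1:
  "theta 3 (1 / 6) = \<theta>3 1 * (sqrt 3 - 1 + sqrt (2 * sqrt 3)) * sqrt (sqrt 3 + 1) / (4 * 3 powr (3 / 8))"
proof -
  define W where "W = sqrt 3 - 1 + sqrt (2 * sqrt 3)"
  have W: "W > 0" by (simp add: W_def add_pos_pos)
  have p4: "(sqrt (x::real)) ^ 4 = x\<^sup>2" if "x \<ge> 0" for x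
    using that power_mult[of "sqrt x" 2 2] by simp
  have "(3 powr (3 / 8)) ^ 4 = (3::real) powr (1 + 1 / 2)" by (simp add: powr_power)
  also have "\<dots> = 3 * sqrt 3" by (subst powr_add) (simp add: powr_half_sqrt)
  finally have p8: "(3 powr (3 / 8)) ^ 4 = 3 * sqrt 3" .
  have "theta 3 (1 / 6) ^ 4 = \<theta>3 3 ^ 4 * 2 * W ^ 4 / 256"
    unfolding theta_3_sixth_eq W_def[symmetric] by (simp add: power_mult_distrib power_divide p4)
  moreover have "(\<theta>3 1 * W * sqrt (sqrt 3 + 1) / (4 * 3 powr (3 / 8))) ^ 4 =
     \<theta>3 3 ^ 4 * ((6 * sqrt 3 - 9) * (sqrt 3 + 1)\<^sup>2 / (3 * sqrt 3)) * W ^ 4 / 256"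
    by (simp add: power_mult_distrib power_divide p4 p8 \<theta>3_3)
  moreover have "(6 * sqrt 3 - 9) * (sqrt 3 + 1)\<^sup>2 / (3 * sqrt 3) = 2"
    by (simp add: power2_eq_square field_simps)
  ultimately have "theta 3 (1 / 6) ^ 4 = (\<theta>3 1 * W * sqrt (sqrt 3 + 1) / (4 * 3 powr (3 / 8))) ^ 4"
    by simp
  then show ?thesis
    unfolding W_def[symmetric]
    by (rule power_eq_imp_eq_base) (use W theta_pos[of 3] theta_pos[of 1] in \<open>auto intro!: less_imp_le divide_pos_pos mult_pos_pos add_pos_pos\<close>)
qed

section \<open>Radical arithmetic with the fourth root of 12\<close>

lemma quartic_reduction:
  fixes z :: real
  assumes z4: "z ^ 4 = 12"
  shows "(z\<^sup>2 + 2 * z - 2) ^ 3 * (z\<^sup>2 + 2) ^ 4 * (z ^ 3 + z\<^sup>2 + 2)\<^sup>2 = 512 * (z ^ 3 + 2 * z\<^sup>2 + 6 * z + 8) ^ 3"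
proof -
  \<comment> \<open>Used as rewrite rules, these reduce every power of \<open>z\<close> from the
    fourth on; each factor is normalized to degree at most 3 before the next multiplication.\<close>
  have e: "z * (z * (z * z)) = 12" "\<And>x. z * (z * (z * (z * x))) = 12 * x"
    using z4 by (simp_all add: power4_eq_xxxx mult.assoc[symmetric])
  note r = e power2_eq_square power3_eq_cube algebra_simps
  have 1: "(z\<^sup>2 + 2 * z - 2) ^ 3 = 64 + 96 * z - 16 * z ^ 3" by (simp add: r)
  have 2: "(z\<^sup>2 + 2) ^ 4 = 448 + 128 * z\<^sup>2" by (simp add: r power4_eq_xxxx)
  have 3: "(64 + 96 * z - 16 * z ^ 3) * (448 + 128 * z\<^sup>2) = 128 * (224 + 144 * z + 64 * z\<^sup>2 + 40 * z ^ 3)"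
    by (simp add: r)
  have 4: "(z ^ 3 + z\<^sup>2 + 2)\<^sup>2 = 4 * (4 + 6 * z + 4 * z\<^sup>2 + z ^ 3)" by (simp add: r)
  have 5: "(224 + 144 * z + 64 * z\<^sup>2 + 40 * z ^ 3) * (4 + 6 * z + 4 * z\<^sup>2 + z ^ 3) =
      8576 + 4608 * z + 2496 * z\<^sup>2 + 1344 * z ^ 3" by (simp add: r)
  have 6: "(z ^ 3 + 2 * z\<^sup>2 + 6 * z + 8) ^ 3 = 8576 + 4608 * z + 2496 * z\<^sup>2 + 1344 * z ^ 3" by (simp add: r)
  have 7: "128 * x * (4 * y) = 512 * (x * y)" for x y :: real by simp
  show ?thesis unfolding 1 2 3 4 6 7 5 ..
qed

text \<open>All radicals are polynomials in z = sqrt (2 * sqrt 3), whose fourth power is 12.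
  Combining sqrt s with s powr (5 / 6) leaves exponents 4/3 and 2/3, so cubing reduces the claim to
  a polynomial identity in \<open>z\<close>.\<close>

lemma radical_identity:
  "(sqrt 3 - 1 + sqrt (2 * sqrt 3)) * sqrt (sqrt 3 + 1) / 4 =
    (2 + sqrt 3 + 1 / 2 * (sqrt 2 + sqrt 6) * 3 powr (3 / 4)) /
      ((sqrt 3 + 1) powr (5 / 6) * (1 + sqrt 3 + sqrt 2 * 3 powr (3 / 4)) powr (2 / 3))"
proof -
  define z where "z = sqrt (2 * sqrt 3)"
  define W s D N where "W = z\<^sup>2 / 2 - 1 + z" and "s = z\<^sup>2 / 2 + 1" and "D = 1 + z\<^sup>2 / 2 + z ^ 3 / 2"
    and "N = 2 + z\<^sup>2 / 2 + z ^ 3 / 4 + 3 * z / 2"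
  have z: "z > 0" "z\<^sup>2 = 2 * sqrt 3" by (simp_all add: z_def)
  then have s3: "sqrt 3 = z\<^sup>2 / 2" by simp
  have z4: "z ^ 4 = 12" using power_mult[of z 2 2] by (simp add: z(2) power_mult_distrib)
  have x: "3 powr (3 / 4) = sqrt 3 * sqrt (sqrt (3::real))"
    using powr_add[of 3 "1 / 2" "1 / 4 :: real"] powr_powr[of 3 "1 / 2" "1 / 2 :: real"] by (simp add: powr_half_sqrt)
  have "sqrt 2 * 3 powr (3 / 4) = sqrt 3 * z" by (simp add: x z_def real_sqrt_mult)
  also have "\<dots> = z ^ 3 / 2" unfolding s3 by (simp add: power2_eq_square power3_eq_cube)
  finally have q: "sqrt 2 * 3 powr (3 / 4) = z ^ 3 / 2" .
  have "sqrt 6 = sqrt 2 * sqrt 3" by (simp add: real_sqrt_mult[symmetric])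
  then have q': "sqrt 6 * 3 powr (3 / 4) = 3 * z" by (simp add: x z_def real_sqrt_mult)
  have "W > 0" "s > 0" "D > 0" "N > 0"
    using z(1) real_sqrt_ge_one[of 3] by (simp_all add: W_def s_def D_def N_def z(2) add_pos_pos)
  have "W ^ 3 * s ^ 4 * D\<^sup>2 = 64 * N ^ 3"
  proof -
    have "(z\<^sup>2 + 2 * z - 2) ^ 3 * (z\<^sup>2 + 2) ^ 4 * (z ^ 3 + z\<^sup>2 + 2)\<^sup>2 = 512 * (z ^ 3 + 2 * z\<^sup>2 + 6 * z + 8) ^ 3"
      by (rule quartic_reduction[OF z4])
    moreover have "z\<^sup>2 + 2 * z - 2 = 2 * W" "z\<^sup>2 + 2 = 2 * s" "z ^ 3 + z\<^sup>2 + 2 = 2 * D" "z ^ 3 + 2 * z\<^sup>2 + 6 * z + 8 = 4 * N"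
      by (simp_all add: W_def s_def D_def N_def)
    ultimately show ?thesis by (simp add: power_mult_distrib mult_ac)
  qed
  have "(W * s powr (4 / 3) * D powr (2 / 3)) ^ 3 = W ^ 3 * s ^ 4 * D\<^sup>2"
    using \<open>s > 0\<close> \<open>D > 0\<close> by (simp add: power_mult_distrib powr_power)
  also have "\<dots> = (4 * N) ^ 3"
    using \<open>W ^ 3 * s ^ 4 * D\<^sup>2 = 64 * N ^ 3\<close> by (simp add: power_mult_distrib)
  finally have "W * s powr (4 / 3) * D powr (2 / 3) = 4 * N"
    by (rule power_eq_imp_eq_base) (use \<open>W > 0\<close> \<open>N > 0\<close> in auto)
  moreover have "s powr (4 / 3) = sqrt s * s powr (5 / 6)"
    using \<open>s > 0\<close> powr_add[of s "1 / 2" "5 / 6"] by (simp add: powr_half_sqrt)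
  ultimately have "W * sqrt s / 4 = N / (s powr (5 / 6) * D powr (2 / 3))"
    using \<open>s > 0\<close> \<open>D > 0\<close> by (simp add: field_simps)
  moreover have "2 + sqrt 3 + 1 / 2 * (sqrt 2 + sqrt 6) * 3 powr (3 / 4) = N"
    using q q' by (simp add: N_def s3 algebra_simps)
  moreover have "1 + sqrt 3 + sqrt 2 * 3 powr (3 / 4) = D"
    using q by (simp add: D_def s3)
  moreover have "sqrt 3 - 1 + sqrt (2 * sqrt 3) = W" "sqrt 3 + 1 = s"
    using z(1) by (simp_all add: W_def s_def z_def[symmetric] s3)
  ultimately show ?thesis by simp
qed

lemma eps_exp: "eps (complex_of_real (exp (- 2 * pi))) = complex_of_real (exp (pi / 12) * theta 3 (1 / 6))"
proof -
  have "complex_of_real (exp (- 2 * pi)) powi (k * (3 * k + 1) div 2) =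
      complex_of_real (exp (pi / 12) * exp (- (pi * 3 * (of_int k + 1 / 6)\<^sup>2)))" for k :: int
  proof -
    \<comment> \<open>Parity makes the integer division exact, so the exponent can be handled as a
      real number.\<close>
    have "even (k * (3 * k + 1))" by simp
    then have "2 * real_of_int (k * (3 * k + 1) div 2) = of_int (k * (3 * k + 1))"
      by (metis dvd_mult_div_cancel of_int_mult of_int_numeral)
    then have "of_int (k * (3 * k + 1) div 2) * (- 2 * pi) = - pi * of_int (k * (3 * k + 1))"
      by (metis mult.commute mult.left_commute mult_minus_left)
    also have "\<dots> = pi / 12 + - (pi * 3 * (of_int k + 1 / 6)\<^sup>2)"
      by (simp add: power2_eq_square field_simps)
    finally have "of_int (k * (3 * k + 1) div 2) * (- 2 * pi) = pi / 12 + - (pi * 3 * (of_int k + 1 / 6)\<^sup>2)" .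
    then show ?thesis
      by (simp only: of_real_power_int[symmetric] exp_power_int exp_add)
  qed
  then have "eps (complex_of_real (exp (- 2 * pi))) =
      (\<Sum>\<^sub>\<infinity>k::int. complex_of_real (exp (pi / 12) * exp (- (pi * 3 * (of_int k + 1 / 6)\<^sup>2))))"
    by (simp only: eps_def)
  also have "\<dots> = complex_of_real (exp (pi / 12) * theta 3 (1 / 6))"
    by (intro infsumI has_sum_of_real has_sum_cmult_right theta_has_sum) simp
  finally show ?thesis .
qed

theorem theorem4p7:
  shows "eps (complex_of_real (exp (- 2 * pi))) =
    complex_of_real
      ((exp (pi / 12) * (2 + sqrt 3 + 1 / 2 * (sqrt 2 + sqrt 6) * 3 powr (3 / 4)))
        / (3 powr (3 / 8) * (sqrt 3 + 1) powr (5 / 6)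
            * (1 + sqrt 3 + sqrt 2 * 3 powr (3 / 4)) powr (2 / 3))
        * (pi powr (1 / 4) / Gamma (3 / 4)))"
proof -
  have "exp (pi / 12) * theta 3 (1 / 6) = exp (pi / 12) * (\<theta>3 1 *
      ((sqrt 3 - 1 + sqrt (2 * sqrt 3)) * sqrt (sqrt 3 + 1) / 4) / 3 powr (3 / 8))"
    unfolding theta_3_sixth_eq_\<theta>3_1 by simp
  then show ?thesis
    unfolding eps_exp radical_identity \<theta>3_1 by (simp add: mult_ac)
qed

end
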